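(* Consider the scalar system $X_{k+1}=aX_k+bU_k+W_k$ with observations $Y_k=D_{k-\tau}X_{k-\tau}$, $\tau\ge1$ fixed, with the information structures $I^{\mathcal C}_k,I^{\mathcal S}_k$ given in the context, and the optimization problem $$P_1:\quad \min_{\boldsymbol\pi\in\Pi,\ \boldsymbol\mu\in\Gamma}\ \frac1N\,\mathbb{E}\Big[\sum_{k=0}^{N-1}\big(qX_k^2+rU_k^2\big)+qX_N^2\Big]\quad\text{s.t.}\quad\frac1N\sum_{k=0}^{N-1}D_k\le r_s,$$ where $q,r,r_s>0$. The optimal controller is given by the linear feedback law $$U_k=\gamma_k(I^{\mathcal C}_k)=-L\,\hat X_k,$$ where $$\hat X_k=\mathbb{E}[X_k\mid I^{\mathcal C}_k],\qquad L=\frac{abP}{r+b^2P},\qquad P=a^2P+q-\frac{(abP)^2}{r+b^2P}.$$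
   Context: $X_k$ is the real-valued state, $U_k$ the control input, $a,b\in\mathbb{R}$, and the disturbances $\{W_k\}$ are i.i.d., zero-mean, with finite variance $\sigma_W^2$ and symmetrically distributed about zero. $D_k\in\{0,1\}$ is the scheduling decision at time $k$. The controller's information at time $k$ is $I^{\mathcal C}_k=\{Y_0,U_0,Y_1,U_1,\dots,Y_{k-1},U_{k-1},Y_k\}$ and the scheduler's information is $I^{\mathcal S}_k=\{X_0,D_0,U_0,\dots,X_{k-1},D_{k-1},U_{k-1},X_k\}$. Policies: $U_k=\gamma_k(I^{\mathcal C}_k)$ and $D_k=f_k(I^{\mathcal S}_k)$; $\Gamma$ and $\Pi$ denote the sets of admissible control and scheduling policies $\boldsymbol\mu=(\gamma_0,\gamma_1,\dots)$, $\boldsymbol\pi=(f_0,f_1,\dots)$ satisfying the usual measurability and integrability conditions. $N$ is the finite horizon. Convention: the paper uses the steady-state solution $P$ of the Riccati equation for notational simplicity in place of the time-varying recursion; in the transient case the controller reads $U_k=-L_k\hat X_k$ with $L_k=\frac{abP_{k+1}}{r+b^2P_{k+1}}$, $P_k=a^2P_{k+1}+q-\frac{(abP_{k+1})^2}{r+b^2P_{k+1}}$, $P_N=q$. *)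

theory Defs
  imports "HOL-Probability.Probability"
begin

text \<open>
  Problem data.  The plant is \<open>X (k+1) = a X k + b U k + W k\<close> and the observation channel has
  transmission delay \<open>\<tau>\<close>; all random variables live on the measure space \<open>base\<close>.
\<close>

record 'a control_problem =
  base :: "'a measure"
  init :: "'a \<Rightarrow> real"
  noise :: "nat \<Rightarrow> 'a \<Rightarrow> real"
  coeff_a :: real
  coeff_b :: real
  delay :: nat
  weight_q :: real
  weight_r :: real
  rate :: real
  horizon :: nat

text \<open>
  Policies act on realised information.  The controller sees \<open>(Y\<^sub>0..Y\<^sub>k, U\<^sub>0..U\<^sub>k\<^sub>-\<^sub>1)\<close>, the scheduler
  sees \<open>(X\<^sub>0..X\<^sub>k, D\<^sub>0..D\<^sub>k\<^sub>-\<^sub>1, U\<^sub>0..U\<^sub>k\<^sub>-\<^sub>1)\<close>; each history is an extensional function on its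
  index range, so that it is a point of the corresponding finite product space.
\<close>

type_synonym control_policy = "nat \<Rightarrow> (nat \<Rightarrow> real) \<times> (nat \<Rightarrow> real) \<Rightarrow> real"
type_synonym sched_policy = "nat \<Rightarrow> (nat \<Rightarrow> real) \<times> (nat \<Rightarrow> real) \<times> (nat \<Rightarrow> real) \<Rightarrow> real"

definition control_info_space :: "nat \<Rightarrow> ((nat \<Rightarrow> real) \<times> (nat \<Rightarrow> real)) measure" where
  "control_info_space k =
     (\<Pi>\<^sub>M i\<in>{..k}. borel) \<Otimes>\<^sub>M (\<Pi>\<^sub>M i\<in>{..<k}. borel)"

definition sched_info_space ::
    "nat \<Rightarrow> ((nat \<Rightarrow> real) \<times> (nat \<Rightarrow> real) \<times> (nat \<Rightarrow> real)) measure" where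
  "sched_info_space k =
     (\<Pi>\<^sub>M i\<in>{..k}. borel) \<Otimes>\<^sub>M (\<Pi>\<^sub>M i\<in>{..<k}. borel) \<Otimes>\<^sub>M (\<Pi>\<^sub>M i\<in>{..<k}. borel)"

definition control_policies :: "control_policy set" where
  "control_policies = {\<mu>. \<forall>k. \<mu> k \<in> borel_measurable (control_info_space k)}"

definition sched_policies :: "sched_policy set" where
  "sched_policies =
     {\<pi>. \<forall>k. \<pi> k \<in> borel_measurable (sched_info_space k) \<and>
              (\<forall>h\<in>space (sched_info_space k). \<pi> k h \<in> {0, 1})}"

text \<open>
  The closed loop driven by a scheduling policy \<open>\<pi>\<close> and a control policy \<open>\<mu>\<close>.  Before time \<open>\<tau>\<close>
  nothing can have been delivered yet, so the observation is the uninformative value \<open>0\<close>.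
\<close>

lemma restrict_fundef_cong [fundef_cong]:
  assumes "A = B" "\<And>i. i \<in> B \<Longrightarrow> f i = g i"
  shows "restrict f A = restrict g B"
  using assms by (auto simp: restrict_def)

function
  state :: "'a control_problem \<Rightarrow> sched_policy \<Rightarrow> control_policy \<Rightarrow> nat \<Rightarrow> 'a \<Rightarrow> real" and
  sched :: "'a control_problem \<Rightarrow> sched_policy \<Rightarrow> control_policy \<Rightarrow> nat \<Rightarrow> 'a \<Rightarrow> real" and
  obs :: "'a control_problem \<Rightarrow> sched_policy \<Rightarrow> control_policy \<Rightarrow> nat \<Rightarrow> 'a \<Rightarrow> real" and
  ctrl :: "'a control_problem \<Rightarrow> sched_policy \<Rightarrow> control_policy \<Rightarrow> nat \<Rightarrow> 'a \<Rightarrow> real"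
where
  "state S \<pi> \<mu> 0 \<omega> = init S \<omega>"
| "state S \<pi> \<mu> (Suc k) \<omega> =
     coeff_a S * state S \<pi> \<mu> k \<omega> + coeff_b S * ctrl S \<pi> \<mu> k \<omega> + noise S k \<omega>"
| "sched S \<pi> \<mu> k \<omega> =
     \<pi> k (\<lambda>i\<in>{..k}. state S \<pi> \<mu> i \<omega>, \<lambda>i\<in>{..<k}. sched S \<pi> \<mu> i \<omega>, \<lambda>i\<in>{..<k}. ctrl S \<pi> \<mu> i \<omega>)"
| "obs S \<pi> \<mu> k \<omega> =
     (if delay S \<le> k
      then sched S \<pi> \<mu> (k - delay S) \<omega> * state S \<pi> \<mu> (k - delay S) \<omega> else 0)"
| "ctrl S \<pi> \<mu> k \<omega> = \<mu> k (\<lambda>i\<in>{..k}. obs S \<pi> \<mu> i \<omega>, \<lambda>i\<in>{..<k}. ctrl S \<pi> \<mu> i \<omega>)"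
  by pat_completeness auto
termination
  by (relation "Wellfounded.measure (case_sum
        (case_sum (\<lambda>(S, \<pi>, \<mu>, k, \<omega>). 4 * k) (\<lambda>(S, \<pi>, \<mu>, k, \<omega>). 4 * k + 1))
        (case_sum (\<lambda>(S, \<pi>, \<mu>, k, \<omega>). 4 * k + 2) (\<lambda>(S, \<pi>, \<mu>, k, \<omega>). 4 * k + 3)))")
     auto

declare state.simps [simp del] sched.simps [simp del] obs.simps [simp del] ctrl.simps [simp del]

text \<open>The sigma-algebra generated by \<open>I\<^sup>C\<^sub>k\<close>, and the estimate \<open>E[X k | I\<^sup>C\<^sub>k]\<close>.\<close>

definition control_info ::
    "'a control_problem \<Rightarrow> sched_policy \<Rightarrow> control_policy \<Rightarrow> nat \<Rightarrow> 'a \<Rightarrow> (nat \<Rightarrow> real) \<times> (nat \<Rightarrow> real)"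
where
  "control_info S \<pi> \<mu> k \<omega> =
     (\<lambda>i\<in>{..k}. obs S \<pi> \<mu> i \<omega>, \<lambda>i\<in>{..<k}. ctrl S \<pi> \<mu> i \<omega>)"

definition control_info_algebra ::
    "'a control_problem \<Rightarrow> sched_policy \<Rightarrow> control_policy \<Rightarrow> nat \<Rightarrow> 'a measure" where
  "control_info_algebra S \<pi> \<mu> k =
     vimage_algebra (space (base S)) (control_info S \<pi> \<mu> k) (control_info_space k)"

definition state_estimate ::
    "'a control_problem \<Rightarrow> sched_policy \<Rightarrow> control_policy \<Rightarrow> nat \<Rightarrow> 'a \<Rightarrow> real" where
  "state_estimate S \<pi> \<mu> k =
     real_cond_exp (base S) (control_info_algebra S \<pi> \<mu> k) (state S \<pi> \<mu> k)"

text \<open>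
  Square integrability of the inputs is a condition on the pair of policies, since the inputs depend
  on both of them.  Given a square integrable initial state and square integrable noise, it makes
  every term of the cost integrable.
\<close>

definition admissible :: "'a control_problem \<Rightarrow> sched_policy \<Rightarrow> control_policy \<Rightarrow> bool" where
  "admissible S \<pi> \<mu> \<longleftrightarrow>
     \<pi> \<in> sched_policies \<and> \<mu> \<in> control_policies \<and>
     (\<forall>k<horizon S. integrable (base S) (\<lambda>\<omega>. (ctrl S \<pi> \<mu> k \<omega>)\<^sup>2))"

definition feasible :: "'a control_problem \<Rightarrow> sched_policy \<Rightarrow> control_policy \<Rightarrow> bool" where
  "feasible S \<pi> \<mu> \<longleftrightarrow>
     admissible S \<pi> \<mu> \<and>
     (AE \<omega> in base S. (1 / real (horizon S)) * (\<Sum>k<horizon S. sched S \<pi> \<mu> k \<omega>) \<le> rate S)"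

definition cost :: "'a control_problem \<Rightarrow> sched_policy \<Rightarrow> control_policy \<Rightarrow> real" where
  "cost S \<pi> \<mu> =
     (1 / real (horizon S)) *
     (LINT \<omega>|base S.
        (\<Sum>k<horizon S. weight_q S * (state S \<pi> \<mu> k \<omega>)\<^sup>2 + weight_r S * (ctrl S \<pi> \<mu> k \<omega>)\<^sup>2)
        + weight_q S * (state S \<pi> \<mu> (horizon S) \<omega>)\<^sup>2)"

definition optimal :: "'a control_problem \<Rightarrow> sched_policy \<Rightarrow> control_policy \<Rightarrow> bool" where
  "optimal S \<pi> \<mu> \<longleftrightarrow>
     feasible S \<pi> \<mu> \<and> (\<forall>\<pi>' \<mu>'. feasible S \<pi>' \<mu>' \<longrightarrow> cost S \<pi> \<mu> \<le> cost S \<pi>' \<mu>')"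

text \<open>The Riccati recursion runs backwards in time; \<open>riccati_to_go S j\<close> has \<open>j\<close> steps left.
  The fixed point \<open>P = a\<^sup>2 P + q - (a b P)\<^sup>2 / (r + b\<^sup>2 P)\<close> is only its stationary form: over a finite
  horizon with terminal weight \<open>q\<close> the optimal gain is the time-varying one.\<close>

fun riccati_to_go :: "'a control_problem \<Rightarrow> nat \<Rightarrow> real" where
  "riccati_to_go S 0 = weight_q S"
| "riccati_to_go S (Suc j) =
     (coeff_a S)\<^sup>2 * riccati_to_go S j + weight_q S
     - (coeff_a S * coeff_b S * riccati_to_go S j)\<^sup>2 /
       (weight_r S + (coeff_b S)\<^sup>2 * riccati_to_go S j)"

definition riccati :: "'a control_problem \<Rightarrow> nat \<Rightarrow> real" where
  "riccati S k = riccati_to_go S (horizon S - k)"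

definition gain :: "'a control_problem \<Rightarrow> nat \<Rightarrow> real" where
  "gain S k =
     coeff_a S * coeff_b S * riccati S (Suc k) /
     (weight_r S + (coeff_b S)\<^sup>2 * riccati S (Suc k))"

end

theory Submission
  imports Defs
begin

text \<open>
  Completing squares along the Riccati recursion writes the cost of any admissible pair of policies
  as a constant plus a positively weighted sum of the terms \<open>E (U k + L k * X k)\<^sup>2\<close>, because the
  noise is independent of the current state and input (\<open>cost_completed_squares\<close>).  Orthogonality of
  the estimation error to the controller's information splits each term into
  \<open>E (U k + L k * Xhat k)\<^sup>2 + (L k)\<^sup>2 * E (X k - Xhat k)\<^sup>2\<close>.  Certainty equivalence makes the first
  part zero; the difficulty is that the second part also depends on the control policy, since the
  scheduler reacts to the inputs (the dual effect).

  Joint optimality of the pair removes this difficulty.  Given a loop \<open>(\<pi>, \<mu>)\<close>, a competitor takes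
  the same scheduling decisions and gives its controller the same information, but applies the
  certainty-equivalent input.  Its scheduler and its controller both simulate the given loop
  alongside their own one: they know the inputs of both loops, and so the difference of the two
  states, and can translate transmissions from one loop to the other (\<open>replay_correct\<close>).  The
  competitor's estimation errors are then those of the given loop, and only the terms
  \<open>E (U k + L k * Xhat k)\<^sup>2\<close> distinguish the costs.

  One obstacle remains.  The controller observes only \<open>D * X\<close>, and a transmitted state \<open>0\<close> looks like
  silence.  When the noise has atoms, the certainty-equivalent input can move the state to \<open>0\<close> with
  positive probability and thereby destroy information that the given loop had.  The competitor
  therefore adds a deterministic dither which displaces its states by a constant \<open>\<epsilon>\<close>.  For all but
  countably many \<open>\<epsilon>\<close> no displaced state vanishes with positive probability
  (\<open>generic_dither_visible\<close>), and the dither costs a multiple of \<open>\<epsilon>\<^sup>2\<close>.  Letting \<open>\<epsilon>\<close> tend to \<open>0\<close>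
  shows that an optimal loop has \<open>E (U k + L k * Xhat k)\<^sup>2 = 0\<close> (\<open>optimal_certainty_equivalent\<close>).

  For the converse, the certainty-equivalent law and a fixed scheduling policy determine the loop
  almost surely (\<open>certainty_equivalent_loop_unique\<close>), so every certainty-equivalent loop coincides
  with the optimal one and shares its cost and its use of the channel.
\<close>

section \<open>Square integrability, factorisation and conditional expectation\<close>

definition square_integrable :: "'a measure \<Rightarrow> ('a \<Rightarrow> real) \<Rightarrow> bool" where
  "square_integrable M f \<longleftrightarrow> f \<in> borel_measurable M \<and> integrable M (\<lambda>x. (f x)\<^sup>2)"

lemma square_integrableD:
  assumes "square_integrable M f"
  shows "f \<in> borel_measurable M" "integrable M (\<lambda>x. (f x)\<^sup>2)"
  using assms by (auto simp: square_integrable_def)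

lemma square_integrable_mult:
  assumes "square_integrable M f" "square_integrable M g"
  shows "integrable M (\<lambda>x. f x * g x)"
proof -
  note [measurable] = square_integrableD(1)[OF assms(1)] square_integrableD(1)[OF assms(2)]
  show ?thesis
  proof (rule Bochner_Integration.integrable_bound)
    show "integrable M (\<lambda>x. (f x)\<^sup>2 + (g x)\<^sup>2)"
      using assms by (auto simp: square_integrable_def)
    have "\<bar>f x * g x\<bar> \<le> (f x)\<^sup>2 + (g x)\<^sup>2" for x
    proof -
      have "0 \<le> (\<bar>f x\<bar> - \<bar>g x\<bar>)\<^sup>2" by simp
      then have "2 * \<bar>f x * g x\<bar> \<le> (f x)\<^sup>2 + (g x)\<^sup>2"
        by (simp add: power2_eq_square algebra_simps abs_mult)
      moreover have "0 \<le> \<bar>f x * g x\<bar>" by simp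
      ultimately show ?thesis by linarith
    qed
    then show "AE x in M. norm (f x * g x) \<le> norm ((f x)\<^sup>2 + (g x)\<^sup>2)"
      by simp
  qed simp
qed

lemma square_integrable_cmult:
  assumes "square_integrable M f" shows "square_integrable M (\<lambda>x. c * f x)"
  using assms by (auto simp: square_integrable_def power_mult_distrib)

lemma square_integrable_add:
  assumes "square_integrable M f" "square_integrable M g"
  shows "square_integrable M (\<lambda>x. f x + g x)"
proof -
  have "integrable M (\<lambda>x. (f x)\<^sup>2 + (g x)\<^sup>2 + 2 * (f x * g x))"
    using assms square_integrable_mult[OF assms] by (auto simp: square_integrable_def)
  then show ?thesis
    using assms by (auto simp: square_integrable_def power2_sum algebra_simps)
qed

lemma square_integrable_diff:
  assumes "square_integrable M f" "square_integrable M g"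
  shows "square_integrable M (\<lambda>x. f x - g x)"
  using square_integrable_add[OF assms(1) square_integrable_cmult[OF assms(2), of "-1"]] by simp

lemma (in finite_measure) square_integrable_const: "square_integrable M (\<lambda>x. c)"
  by (auto simp: square_integrable_def)

lemma (in finite_measure) square_integrable_integrable:
  assumes "square_integrable M f" shows "integrable M f"
  using square_integrable_mult[OF assms square_integrable_const[of 1]] by simp

lemma (in finite_measure_subalgebra) square_integrable_cond_exp:
  assumes "square_integrable M f"
  shows "square_integrable M (real_cond_exp M F f)"
proof -
  have "integrable M (\<lambda>x. (real_cond_exp M F f x)\<^sup>2)"
    using square_integrable_integrable[OF assms] square_integrableD(2)[OF assms]
    by (intro integrable_convex_cond_exp[where I=UNIV]) (auto intro: convex_power2)
  then show ?thesis by (simp add: square_integrable_def)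
qed

text \<open>
  The Doob--Dynkin factorisation: \<open>{f < q} = h -` B q\<close> for every rational \<open>q\<close>, and
  \<open>g y = inf {q. y \<in> B q}\<close> recovers \<open>f\<close> from these level sets.
\<close>

lemma vimage_algebra_factorization:
  fixes f :: "'a \<Rightarrow> real"
  assumes f: "f \<in> borel_measurable (vimage_algebra X h N)" and h: "h \<in> X \<rightarrow> space N"
  shows "\<exists>g \<in> borel_measurable N. \<forall>x\<in>X. f x = g (h x)"
proof -
  have "\<exists>B\<in>sets N. {x\<in>X. f x < q} = h -` B \<inter> X" for q
  proof -
    have "f -` {..<q} \<inter> space (vimage_algebra X h N) \<in> sets (vimage_algebra X h N)"
      by (rule measurable_sets[OF f]) auto
    then obtain B where "B \<in> sets N" "f -` {..<q} \<inter> X = h -` B \<inter> X"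
      unfolding sets_vimage_algebra2[OF h] by auto
    then show ?thesis by (intro bexI[of _ B]) auto
  qed
  then obtain B where B [measurable]: "\<And>q. B q \<in> sets N"
    and level: "\<And>q. {x\<in>X. f x < q} = h -` B q \<inter> X"
    by metis
  define G where "G y = (INF q\<in>\<rat>. if y \<in> B q then ereal q else \<infinity>)" for y
  have "G \<in> borel_measurable N"
    unfolding G_def by (rule borel_measurable_INF) (auto simp: countable_rat)
  then have "(\<lambda>y. real_of_ereal (G y)) \<in> borel_measurable N" by simp
  moreover have "f x = real_of_ereal (G (h x))" if "x \<in> X" for x
  proof -
    have mem: "h x \<in> B q \<longleftrightarrow> f x < q" for q
      using level[of q] that by auto
    have "G (h x) = ereal (f x)"
      unfolding G_def mem
    proof (rule antisym)
      show "(INF q\<in>\<rat>. if f x < q then ereal q else \<infinity>) \<le> ereal (f x)"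
      proof (rule ereal_le_epsilon2)
        fix e :: real assume "0 < e"
        then obtain q where "q \<in> \<rat>" "f x < q" "q < f x + e"
          using Rats_dense_in_real[of "f x" "f x + e"] by auto
        then have "(INF q\<in>\<rat>. if f x < q then ereal q else \<infinity>) \<le> ereal q"
          by (intro INF_lower2[of q]) auto
        also have "\<dots> \<le> ereal (f x) + ereal e" using \<open>q < f x + e\<close> by simp
        finally show "(INF q\<in>\<rat>. if f x < q then ereal q else \<infinity>) \<le> ereal (f x) + ereal e" .
      qed
    next
      show "ereal (f x) \<le> (INF q\<in>\<rat>. if f x < q then ereal q else \<infinity>)"
        by (rule INF_greatest) auto
    qed
    then show ?thesis by simp
  qed
  ultimately show ?thesis by (intro bexI[of _ "\<lambda>y. real_of_ereal (G y)"]) auto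
qed

lemma subalgebra_vimage_algebra:
  assumes "h \<in> measurable M N"
  shows "subalgebra M (vimage_algebra (space M) h N)"
  unfolding subalgebra_def
proof (intro conjI)
  show "sets (vimage_algebra (space M) h N) \<subseteq> sets M"
    using measurable_space[OF assms] measurable_sets[OF assms]
    by (subst sets_vimage_algebra2) auto
qed simp

text \<open>
  Writing one conditional expectation as \<open>g \<circ> h\<^sub>1\<close>, the function \<open>g \<circ> h\<^sub>2\<close> has the defining
  averages of the other one, since preimages under \<open>h\<^sub>1\<close> and \<open>h\<^sub>2\<close> differ by null sets only.
\<close>

lemma (in finite_measure) real_cond_exp_AE_cong:
  assumes h1: "h1 \<in> measurable M N" and h2: "h2 \<in> measurable M N"
    and h: "AE x in M. h1 x = h2 x"
    and f1: "integrable M f1" and f2: "integrable M f2" and f: "AE x in M. f1 x = f2 x"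
  shows "AE x in M. real_cond_exp M (vimage_algebra (space M) h1 N) f1 x =
                    real_cond_exp M (vimage_algebra (space M) h2 N) f2 x"
proof -
  let ?F1 = "vimage_algebra (space M) h1 N" and ?F2 = "vimage_algebra (space M) h2 N"
  interpret F1: finite_measure_subalgebra M ?F1
    by unfold_locales (rule subalgebra_vimage_algebra[OF h1])
  interpret F2: finite_measure_subalgebra M ?F2
    by unfold_locales (rule subalgebra_vimage_algebra[OF h2])
  obtain g where g [measurable]: "g \<in> borel_measurable N"
    and g_eq: "\<And>x. x \<in> space M \<Longrightarrow> real_cond_exp M ?F1 f1 x = g (h1 x)"
    using vimage_algebra_factorization[OF borel_measurable_cond_exp[of M ?F1 f1]]
      measurable_space[OF h1] by blast
  have ae: "AE x in M. real_cond_exp M ?F1 f1 x = g (h2 x)"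
    using h g_eq by (auto simp: AE_space)
  note [measurable] = h1 h2
  have int: "integrable M (\<lambda>x. g (h2 x))"
    using F1.real_cond_exp_int(1)[OF f1] ae
    by (subst integrable_cong_AE[symmetric]) (auto simp: measurable_compose[OF h2 g])
  have "AE x in M. real_cond_exp M ?F2 f2 x = g (h2 x)"
  proof (rule F2.real_cond_exp_charact[OF _ f2 int])
    fix A assume "A \<in> sets ?F2"
    then obtain B where [measurable]: "B \<in> sets N" and A: "A = h2 -` B \<inter> space M"
      using measurable_space[OF h2] by (subst (asm) sets_vimage_algebra2) auto
    define A1 where "A1 = h1 -` B \<inter> space M"
    have A1: "A1 \<in> sets ?F1"
      unfolding A1_def by (rule in_vimage_algebra) simp
    have [measurable]: "A \<in> sets M" "A1 \<in> sets M"
      unfolding A A1_def by simp_all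
    have A_ae: "AE x in M. (x \<in> A) = (x \<in> A1)"
      using h by (auto simp: A A1_def)
    note [measurable] = borel_measurable_integrable[OF f1] borel_measurable_integrable[OF f2]
      borel_measurable_integrable[OF int]
    have "(\<integral>x\<in>A. f2 x \<partial>M) = (\<integral>x\<in>A1. f1 x \<partial>M)"
      unfolding set_lebesgue_integral_def
      using f A_ae by (intro integral_cong_AE) (auto simp: indicator_def)
    also have "\<dots> = (\<integral>x\<in>A1. real_cond_exp M ?F1 f1 x \<partial>M)"
      by (rule F1.real_cond_exp_intA[OF f1 A1])
    also have "\<dots> = (\<integral>x\<in>A. g (h2 x) \<partial>M)"
      unfolding set_lebesgue_integral_def
      using ae A_ae by (intro integral_cong_AE) (auto simp: indicator_def)
    finally show "(\<integral>x\<in>A. f2 x \<partial>M) = (\<integral>x\<in>A. g (h2 x) \<partial>M)" .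
  next
    show "(\<lambda>x. g (h2 x)) \<in> borel_measurable ?F2"
      by (rule measurable_compose[OF measurable_vimage_algebra1 g])
        (use measurable_space[OF h2] in auto)
  qed
  with ae show ?thesis by auto
qed

text \<open>
  The best estimate splits the mean square of \<open>u + l X\<close> with \<open>u\<close> known to the estimator: only the
  first term can be influenced by \<open>u\<close>.
\<close>

lemma (in finite_measure_subalgebra) integral_sq_cond_exp_decomp:
  assumes u: "square_integrable M u" "u \<in> borel_measurable F" and X: "square_integrable M X"
  defines "Z \<equiv> real_cond_exp M F X"
  shows "(LINT x|M. (u x + l * X x)\<^sup>2) =
    (LINT x|M. (u x + l * Z x)\<^sup>2) + l\<^sup>2 * (LINT x|M. (X x - Z x)\<^sup>2)"
proof -
  have Z: "square_integrable M Z" unfolding Z_def by (rule square_integrable_cond_exp[OF X])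
  have ZF: "Z \<in> borel_measurable F" unfolding Z_def by simp
  define v where "v x = u x + l * Z x" for x
  have v: "square_integrable M v"
    unfolding v_def by (intro square_integrable_add square_integrable_cmult u Z)
  have vF: "v \<in> borel_measurable F" unfolding v_def using u(2) ZF by measurable
  define e where "e x = X x - Z x" for x
  have e: "square_integrable M e" unfolding e_def by (intro square_integrable_diff X Z)
  have "(LINT x|M. v x * Z x) = (LINT x|M. v x * X x)"
    unfolding Z_def by (rule real_cond_exp_intg(2)[OF square_integrable_mult[OF v X] vF])
      (rule square_integrableD(1)[OF X])
  then have orth: "(LINT x|M. v x * e x) = 0"
    using square_integrable_mult[OF v X] square_integrable_mult[OF v Z]
    by (simp add: e_def right_diff_distrib)
  have "(LINT x|M. (u x + l * X x)\<^sup>2) = (LINT x|M. (v x)\<^sup>2 + 2 * l * (v x * e x) + l\<^sup>2 * (e x)\<^sup>2)"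
    by (rule Bochner_Integration.integral_cong)
      (simp_all add: v_def e_def power2_eq_square algebra_simps)
  also have "\<dots> = (LINT x|M. (v x)\<^sup>2) + l\<^sup>2 * (LINT x|M. (e x)\<^sup>2)"
    using square_integrableD(2)[OF v] square_integrableD(2)[OF e] square_integrable_mult[OF v e] orth
    by simp
  finally show ?thesis unfolding v_def e_def .
qed

section \<open>The closed loop as a family of random variables\<close>

lemma in_space_PiM_borel: "restrict x K \<in> space (\<Pi>\<^sub>M i\<in>K. borel :: real measure)"
  by (auto simp: space_PiM)

definition sched_info ::
    "'a control_problem \<Rightarrow> sched_policy \<Rightarrow> control_policy \<Rightarrow> nat \<Rightarrow> 'a \<Rightarrow>
      (nat \<Rightarrow> real) \<times> (nat \<Rightarrow> real) \<times> (nat \<Rightarrow> real)"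
where
  "sched_info S \<pi> \<mu> k \<omega> =
     (\<lambda>i\<in>{..k}. state S \<pi> \<mu> i \<omega>, \<lambda>i\<in>{..<k}. sched S \<pi> \<mu> i \<omega>, \<lambda>i\<in>{..<k}. ctrl S \<pi> \<mu> i \<omega>)"

lemma sched_eq_sched_info: "sched S \<pi> \<mu> k = (\<lambda>\<omega>. \<pi> k (sched_info S \<pi> \<mu> k \<omega>))"
  unfolding sched_info_def by (rule ext) (rule sched.simps)

lemma ctrl_eq_control_info: "ctrl S \<pi> \<mu> k = (\<lambda>\<omega>. \<mu> k (control_info S \<pi> \<mu> k \<omega>))"
  unfolding control_info_def by (rule ext) (rule ctrl.simps)

lemma obs_eq:
  "obs S \<pi> \<mu> k = (\<lambda>\<omega>. if delay S \<le> k
     then sched S \<pi> \<mu> (k - delay S) \<omega> * state S \<pi> \<mu> (k - delay S) \<omega> else 0)"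
  by (rule ext) (rule obs.simps)

text \<open>
  The measure \<open>M\<close> is left open: for the base space this is plain measurability, and for the algebra
  generated by the data up to time \<open>k\<close> it says that the loop is nonanticipative.
\<close>

lemma closed_loop_measurable:
  assumes pi: "\<pi> \<in> sched_policies" and mu: "\<mu> \<in> control_policies"
    and init: "init S \<in> borel_measurable M"
    and noise: "\<And>i. i < k \<Longrightarrow> noise S i \<in> borel_measurable M"
  shows "state S \<pi> \<mu> k \<in> borel_measurable M" "sched S \<pi> \<mu> k \<in> borel_measurable M"
    "obs S \<pi> \<mu> k \<in> borel_measurable M" "ctrl S \<pi> \<mu> k \<in> borel_measurable M"
proof -
  have "state S \<pi> \<mu> k \<in> borel_measurable M \<and> sched S \<pi> \<mu> k \<in> borel_measurable M \<and>
    obs S \<pi> \<mu> k \<in> borel_measurable M \<and> ctrl S \<pi> \<mu> k \<in> borel_measurable M"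
    using noise
  proof (induction k rule: less_induct)
    case (less k)
    have past [measurable]: "state S \<pi> \<mu> i \<in> borel_measurable M" "sched S \<pi> \<mu> i \<in> borel_measurable M"
      "obs S \<pi> \<mu> i \<in> borel_measurable M" "ctrl S \<pi> \<mu> i \<in> borel_measurable M" if "i < k" for i
      using less.IH[OF that] less.prems that by auto
    have X [measurable]: "state S \<pi> \<mu> k \<in> borel_measurable M"
    proof (cases k)
      case 0
      then show ?thesis using init by (simp add: state.simps(1)[abs_def])
    next
      case (Suc j)
      then have [measurable]: "state S \<pi> \<mu> j \<in> borel_measurable M" "ctrl S \<pi> \<mu> j \<in> borel_measurable M"
        "noise S j \<in> borel_measurable M"
        using past less.prems by auto
      show ?thesis unfolding Suc state.simps(2)[abs_def] by measurable
    qed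
    have X': "state S \<pi> \<mu> i \<in> borel_measurable M" if "i \<le> k" for i
      using that past X by (cases "i = k") auto
    have D [measurable]: "sched S \<pi> \<mu> k \<in> borel_measurable M"
    proof -
      have "sched_info S \<pi> \<mu> k \<in> measurable M (sched_info_space k)"
        unfolding sched_info_space_def sched_info_def[abs_def]
        by (intro measurable_Pair measurable_restrict) (auto intro: X' past)
      moreover have "\<pi> k \<in> borel_measurable (sched_info_space k)"
        using pi by (auto simp: sched_policies_def)
      ultimately show ?thesis
        unfolding sched_eq_sched_info by (rule measurable_compose)
    qed
    have D': "sched S \<pi> \<mu> i \<in> borel_measurable M" if "i \<le> k" for i
      using that past D by (cases "i = k") auto
    have Y: "obs S \<pi> \<mu> k \<in> borel_measurable M"
    proof -
      have [measurable]: "sched S \<pi> \<mu> (k - delay S) \<in> borel_measurable M"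
        "state S \<pi> \<mu> (k - delay S) \<in> borel_measurable M"
        using X' D' by auto
      show ?thesis unfolding obs_eq by measurable
    qed
    have Y': "obs S \<pi> \<mu> i \<in> borel_measurable M" if "i \<le> k" for i
      using that past Y by (cases "i = k") auto
    have "ctrl S \<pi> \<mu> k \<in> borel_measurable M"
    proof -
      have "control_info S \<pi> \<mu> k \<in> measurable M (control_info_space k)"
        unfolding control_info_space_def control_info_def[abs_def]
        by (intro measurable_Pair measurable_restrict) (auto intro: Y' past)
      moreover have "\<mu> k \<in> borel_measurable (control_info_space k)"
        using mu by (auto simp: control_policies_def)
      ultimately show ?thesis
        unfolding ctrl_eq_control_info by (rule measurable_compose)
    qed
    with X D Y show ?case by auto
  qed
  then show "state S \<pi> \<mu> k \<in> borel_measurable M" "sched S \<pi> \<mu> k \<in> borel_measurable M"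
    "obs S \<pi> \<mu> k \<in> borel_measurable M" "ctrl S \<pi> \<mu> k \<in> borel_measurable M"
    by auto
qed

lemma sched_0_1:
  assumes "\<pi> \<in> sched_policies" shows "sched S \<pi> \<mu> k \<omega> = 0 \<or> sched S \<pi> \<mu> k \<omega> = 1"
proof -
  have "sched_info S \<pi> \<mu> k \<omega> \<in> space (sched_info_space k)"
    unfolding sched_info_space_def sched_info_def space_pair_measure
    by (auto intro: in_space_PiM_borel)
  then show ?thesis
    using assms unfolding sched_eq_sched_info sched_policies_def by auto
qed

lemma control_info_in_space: "control_info S \<pi> \<mu> k \<omega> \<in> space (control_info_space k)"
  unfolding control_info_space_def control_info_def space_pair_measure
  by (auto intro: in_space_PiM_borel)

section \<open>Completion of squares\<close>

definition input_weight :: "'a control_problem \<Rightarrow> nat \<Rightarrow> real" where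
  "input_weight S k = weight_r S + (coeff_b S)\<^sup>2 * riccati S (Suc k)"

lemma riccati_to_go_pos:
  assumes "weight_q S > 0" "weight_r S > 0"
  shows "riccati_to_go S j > 0"
proof (induction j)
  case (Suc j)
  define P where "P = riccati_to_go S j"
  have P: "P > 0" using Suc by (simp add: P_def)
  have R: "weight_r S + (coeff_b S)\<^sup>2 * P > 0"
    using P assms by (simp add: add_pos_nonneg)
  \<comment> \<open>The Riccati step in the form without cancellation.\<close>
  have "riccati_to_go S (Suc j) =
      weight_q S + (coeff_a S)\<^sup>2 * P * weight_r S / (weight_r S + (coeff_b S)\<^sup>2 * P)"
    using R by (simp add: P_def[symmetric] field_simps power2_eq_square)
  moreover have "0 \<le> (coeff_a S)\<^sup>2 * P * weight_r S / (weight_r S + (coeff_b S)\<^sup>2 * P)"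
    using assms P R by simp
  ultimately show ?case
    using assms by linarith
qed (use assms in simp)

locale lq_system =
  fixes S :: "'a control_problem"
  assumes prob: "prob_space (base S)"
    and init_sq: "integrable (base S) (\<lambda>\<omega>. (init S \<omega>)\<^sup>2)"
    and indep: "prob_space.indep_vars (base S) (\<lambda>_. borel) (case_nat (init S) (noise S)) UNIV"
    and mean: "\<And>k. (LINT \<omega>|base S. noise S k \<omega>) = 0"
    and var: "\<And>k. integrable (base S) (\<lambda>\<omega>. (noise S k \<omega>)\<^sup>2)"
    and delay_pos: "1 \<le> delay S"
    and q_pos: "weight_q S > 0" and r_pos: "weight_r S > 0"
begin

sublocale prob_space "base S" by (rule prob)

lemma riccati_pos: "riccati S k > 0"
  unfolding riccati_def by (rule riccati_to_go_pos[OF q_pos r_pos])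

lemma input_weight_pos: "input_weight S k > 0"
  unfolding input_weight_def using r_pos riccati_pos[of "Suc k"] by (simp add: add_pos_nonneg)

lemma primitive_measurable:
  "init S \<in> borel_measurable (base S)" "noise S k \<in> borel_measurable (base S)"
proof -
  have *: "case_nat (init S) (noise S) i \<in> borel_measurable (base S)" for i
    using indep unfolding indep_vars_def by auto
  show "init S \<in> borel_measurable (base S)" using *[of 0] by simp
  show "noise S k \<in> borel_measurable (base S)" using *[of "Suc k"] by simp
qed

lemma init_L2: "square_integrable (base S) (init S)"
  using init_sq primitive_measurable by (simp add: square_integrable_def)

lemma noise_L2: "square_integrable (base S) (noise S k)"
  using var primitive_measurable by (simp add: square_integrable_def)

lemmas measurable_base = closed_loop_measurable[OF _ _ primitive_measurable]

lemma control_info_measurable: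
  assumes "\<pi> \<in> sched_policies" "\<mu> \<in> control_policies"
  shows "control_info S \<pi> \<mu> k \<in> measurable (base S) (control_info_space k)"
  unfolding control_info_space_def control_info_def[abs_def]
  by (intro measurable_Pair measurable_restrict) (auto intro: measurable_base assms)

lemma admissible_L2:
  assumes "admissible S \<pi> \<mu>"
  shows "k < horizon S \<Longrightarrow> square_integrable (base S) (ctrl S \<pi> \<mu> k)"
    and "k \<le> horizon S \<Longrightarrow> square_integrable (base S) (state S \<pi> \<mu> k)"
proof -
  have pol: "\<pi> \<in> sched_policies" "\<mu> \<in> control_policies"
    using assms by (auto simp: admissible_def)
  show U: "square_integrable (base S) (ctrl S \<pi> \<mu> k)" if "k < horizon S" for k
    using assms that measurable_base(4)[OF pol] by (auto simp: square_integrable_def admissible_def)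
  show "square_integrable (base S) (state S \<pi> \<mu> k)" if "k \<le> horizon S"
    using that
  proof (induction k)
    case 0
    then show ?case using init_L2 by (simp add: state.simps(1)[abs_def])
  next
    case (Suc k)
    then show ?case unfolding state.simps(2)[abs_def]
      by (intro square_integrable_add square_integrable_cmult noise_L2 U) auto
  qed
qed

text \<open>
  State and input at time \<open>k\<close> are functions of the initial state and the noise before time \<open>k\<close>,
  hence independent of the zero-mean \<open>noise S k\<close>, whatever the policies do.
\<close>

lemma noise_orthogonal:
  assumes adm: "admissible S \<pi> \<mu>" and k: "k < horizon S"
  defines "f \<equiv> \<lambda>\<omega>. coeff_a S * state S \<pi> \<mu> k \<omega> + coeff_b S * ctrl S \<pi> \<mu> k \<omega>"
  shows "(LINT \<omega>|base S. f \<omega> * noise S k \<omega>) = 0"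
proof -
  have pol: "\<pi> \<in> sched_policies" "\<mu> \<in> control_policies"
    using adm by (auto simp: admissible_def)
  define X where "X = case_nat (init S) (noise S)"
  define N where "N = (\<Pi>\<^sub>M i\<in>{..k}. borel :: real measure)"
  define h where "h = (\<lambda>\<omega>. \<lambda>i\<in>{..k}. X i \<omega>)"
  define F where "F = vimage_algebra (space (base S)) h N"
  have h: "h \<in> space (base S) \<rightarrow> space N"
    unfolding h_def N_def by (auto intro: in_space_PiM_borel)
  have "X i \<in> borel_measurable F" if "i \<le> k" for i
  proof -
    have "(\<lambda>\<omega>. h \<omega> i) \<in> borel_measurable F"
      unfolding F_def
      by (rule measurable_compose[OF measurable_vimage_algebra1[OF h]])
        (use that in \<open>simp add: N_def\<close>)
    then show ?thesis using that by (simp add: h_def)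
  qed
  from this[of 0] this[of "Suc i" for i]
  have "init S \<in> borel_measurable F" "\<And>i. i < k \<Longrightarrow> noise S i \<in> borel_measurable F"
    by (auto simp: X_def)
  note [measurable] = closed_loop_measurable[OF pol this]
  have "f \<in> borel_measurable F" unfolding f_def by measurable
  then obtain g where g: "g \<in> borel_measurable N" and f_eq: "\<And>\<omega>. \<omega> \<in> space (base S) \<Longrightarrow> f \<omega> = g (h \<omega>)"
    using vimage_algebra_factorization[of f "space (base S)" h N] h unfolding F_def by blast
  have "indep_var N h (\<Pi>\<^sub>M i\<in>{Suc k}. borel) (\<lambda>\<omega>. \<lambda>i\<in>{Suc k}. X i \<omega>)"
    unfolding N_def h_def using indep by (intro indep_var_restrict[where I=UNIV]) (auto simp: X_def)
  then have "indep_var borel (g \<circ> h) borel ((\<lambda>x. x (Suc k)) \<circ> (\<lambda>\<omega>. \<lambda>i\<in>{Suc k}. X i \<omega>))"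
    using g by (rule indep_var_compose) simp
  moreover have "(\<lambda>x. x (Suc k)) \<circ> (\<lambda>\<omega>. \<lambda>i\<in>{Suc k}. X i \<omega>) = noise S k"
    by (auto simp: X_def)
  ultimately have ind: "indep_var borel (g \<circ> h) borel (noise S k)" by simp
  have "integrable (base S) f"
    unfolding f_def using k
    by (intro square_integrable_integrable square_integrable_add square_integrable_cmult
        admissible_L2[OF adm]) auto
  then have "integrable (base S) (g \<circ> h)"
    by (subst Bochner_Integration.integrable_cong[where g=f]) (auto simp: f_eq)
  moreover have "integrable (base S) (noise S k)"
    by (rule square_integrable_integrable[OF noise_L2])
  ultimately have "(LINT \<omega>|base S. (g \<circ> h) \<omega> * noise S k \<omega>) = 0"
    using indep_var_lebesgue_integral[OF ind] mean by simp
  then show ?thesis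
    by (subst Bochner_Integration.integral_cong[where g="\<lambda>\<omega>. (g \<circ> h) \<omega> * noise S k \<omega>"])
      (auto simp: f_eq)
qed

text \<open>
  One step of dynamic programming with the cost-to-go \<open>riccati S k * x\<^sup>2\<close>: completing the square
  in the input is a pointwise identity up to a term linear in the noise, which has mean zero.
\<close>

lemma stage_cost:
  assumes adm: "admissible S \<pi> \<mu>" and k: "k < horizon S"
  defines "X \<equiv> state S \<pi> \<mu>" and "U \<equiv> ctrl S \<pi> \<mu>"
  shows "(LINT \<omega>|base S. weight_q S * (X k \<omega>)\<^sup>2 + weight_r S * (U k \<omega>)\<^sup>2)
      + riccati S (Suc k) * (LINT \<omega>|base S. (X (Suc k) \<omega>)\<^sup>2) =
    riccati S k * (LINT \<omega>|base S. (X k \<omega>)\<^sup>2)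
      + riccati S (Suc k) * (LINT \<omega>|base S. (noise S k \<omega>)\<^sup>2)
      + input_weight S k * (LINT \<omega>|base S. (U k \<omega> + gain S k * X k \<omega>)\<^sup>2)"
proof -
  have L2: "square_integrable (base S) (X k)" "square_integrable (base S) (X (Suc k))"
    "square_integrable (base S) (U k)"
    unfolding X_def U_def using k by (auto intro: admissible_L2[OF adm])
  define f where "f \<omega> = coeff_a S * X k \<omega> + coeff_b S * U k \<omega>" for \<omega>
  define v where "v \<omega> = U k \<omega> + gain S k * X k \<omega>" for \<omega>
  have fv: "square_integrable (base S) f" "square_integrable (base S) v"
    unfolding f_def v_def by (intro square_integrable_add square_integrable_cmult L2)+
  note int [simp] = L2[THEN square_integrableD(2)] fv[THEN square_integrableD(2)]
    square_integrable_mult[OF fv(1) noise_L2] var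
  define P where "P = riccati S (Suc k)"
  have P: "riccati S k = (coeff_a S)\<^sup>2 * P + weight_q S - (coeff_a S * coeff_b S * P)\<^sup>2 / input_weight S k"
  proof -
    have "horizon S - k = Suc (horizon S - Suc k)" using k by simp
    then show ?thesis by (simp add: riccati_def P_def input_weight_def)
  qed
  have R: "input_weight S k = weight_r S + (coeff_b S)\<^sup>2 * P"
    and L: "gain S k = coeff_a S * coeff_b S * P / input_weight S k"
    by (simp_all add: input_weight_def gain_def P_def)
  have alg: "weight_q S * (X k \<omega>)\<^sup>2 + weight_r S * (U k \<omega>)\<^sup>2 + P * (X (Suc k) \<omega>)\<^sup>2 =
      riccati S k * (X k \<omega>)\<^sup>2 + P * (noise S k \<omega>)\<^sup>2 + input_weight S k * (v \<omega>)\<^sup>2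
      + 2 * P * (f \<omega> * noise S k \<omega>)" for \<omega>
  proof -
    define x u w where "x = X k \<omega>" and "u = U k \<omega>" and "w = noise S k \<omega>"
    define T where "T = coeff_a S * coeff_b S * P"
    have step: "X (Suc k) \<omega> = coeff_a S * x + coeff_b S * u + w"
      by (simp add: X_def U_def x_def u_def w_def state.simps)
    have "input_weight S k * (v \<omega>)\<^sup>2 =
        input_weight S k * u\<^sup>2 + 2 * T * u * x + T\<^sup>2 / input_weight S k * x\<^sup>2"
    proof -
      define \<rho> where "\<rho> = input_weight S k"
      have "\<rho> \<noteq> 0" using input_weight_pos[of k] by (simp add: \<rho>_def)
      then have "\<rho> * (u + T / \<rho> * x)\<^sup>2 = \<rho> * u\<^sup>2 + 2 * T * u * x + T\<^sup>2 / \<rho> * x\<^sup>2"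
        by (simp add: power2_eq_square field_simps)
      then show ?thesis by (simp add: v_def L \<rho>_def x_def u_def T_def)
    qed
    then show ?thesis
      unfolding step P by (simp add: f_def x_def[symmetric] u_def[symmetric] w_def[symmetric] R T_def
          power2_eq_square algebra_simps)
  qed
  have orth: "(LINT \<omega>|base S. f \<omega> * noise S k \<omega>) = 0"
    unfolding f_def X_def U_def by (rule noise_orthogonal[OF adm k])
  have "(LINT \<omega>|base S. weight_q S * (X k \<omega>)\<^sup>2 + weight_r S * (U k \<omega>)\<^sup>2)
      + P * (LINT \<omega>|base S. (X (Suc k) \<omega>)\<^sup>2) =
    (LINT \<omega>|base S. weight_q S * (X k \<omega>)\<^sup>2 + weight_r S * (U k \<omega>)\<^sup>2 + P * (X (Suc k) \<omega>)\<^sup>2)"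
    by simp
  also have "\<dots> = (LINT \<omega>|base S. riccati S k * (X k \<omega>)\<^sup>2 + P * (noise S k \<omega>)\<^sup>2
      + input_weight S k * (v \<omega>)\<^sup>2 + 2 * P * (f \<omega> * noise S k \<omega>))"
    by (simp only: alg)
  also have "\<dots> = riccati S k * (LINT \<omega>|base S. (X k \<omega>)\<^sup>2) + P * (LINT \<omega>|base S. (noise S k \<omega>)\<^sup>2)
      + input_weight S k * (LINT \<omega>|base S. (v \<omega>)\<^sup>2)"
    by (simp add: orth)
  finally show ?thesis by (simp add: P_def v_def)
qed

definition uncontrollable_cost :: real where
  "uncontrollable_cost = riccati S 0 * (LINT \<omega>|base S. (init S \<omega>)\<^sup>2) +
     (\<Sum>k<horizon S. riccati S (Suc k) * (LINT \<omega>|base S. (noise S k \<omega>)\<^sup>2))"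

lemma cost_completed_squares:
  assumes adm: "admissible S \<pi> \<mu>"
  shows "cost S \<pi> \<mu> = 1 / real (horizon S) * (uncontrollable_cost +
    (\<Sum>k<horizon S. input_weight S k *
       (LINT \<omega>|base S. (ctrl S \<pi> \<mu> k \<omega> + gain S k * state S \<pi> \<mu> k \<omega>)\<^sup>2)))"
proof -
  let ?X = "state S \<pi> \<mu>" and ?U = "ctrl S \<pi> \<mu>"
  let ?c = "\<lambda>k \<omega>. weight_q S * (?X k \<omega>)\<^sup>2 + weight_r S * (?U k \<omega>)\<^sup>2"
  have tele: "(\<Sum>k<n. LINT \<omega>|base S. ?c k \<omega>) + riccati S n * (LINT \<omega>|base S. (?X n \<omega>)\<^sup>2) =
     riccati S 0 * (LINT \<omega>|base S. (?X 0 \<omega>)\<^sup>2)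
     + (\<Sum>k<n. riccati S (Suc k) * (LINT \<omega>|base S. (noise S k \<omega>)\<^sup>2)
         + input_weight S k * (LINT \<omega>|base S. (?U k \<omega> + gain S k * ?X k \<omega>)\<^sup>2))"
    if "n \<le> horizon S" for n
    using that
  proof (induction n)
    case (Suc n)
    then show ?case using stage_cost[OF adm, of n] by simp
  qed simp
  have int: "integrable (base S) (?c k)" if "k < horizon S" for k
    using that admissible_L2[OF adm, of k, THEN square_integrableD(2)] by auto
  have intN: "integrable (base S) (\<lambda>\<omega>. (?X (horizon S) \<omega>)\<^sup>2)"
    by (rule admissible_L2[OF adm, THEN square_integrableD(2)]) simp
  have "(LINT \<omega>|base S. (\<Sum>k<horizon S. ?c k \<omega>) + weight_q S * (?X (horizon S) \<omega>)\<^sup>2) =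
      (\<Sum>k<horizon S. LINT \<omega>|base S. ?c k \<omega>) + weight_q S * (LINT \<omega>|base S. (?X (horizon S) \<omega>)\<^sup>2)"
    using int intN
    by (subst Bochner_Integration.integral_add) (auto simp: Bochner_Integration.integral_sum)
  moreover have "riccati S (horizon S) = weight_q S" by (simp add: riccati_def)
  ultimately show ?thesis
    using tele[of "horizon S"]
    by (simp add: cost_def uncontrollable_cost_def sum.distrib state.simps(1) algebra_simps)
qed

end

section \<open>Replaying one closed loop inside another\<close>

text \<open>
  A party that runs the inputs \<open>u\<close> can simulate the loop of the control policy \<open>\<mu>\<close> alongside:
  \<open>deviation\<close> is the actual state minus the simulated one, and \<open>\<rho> j\<close> turns the deviation at time
  \<open>j\<close> into the simulated transmission \<open>D j * X j\<close>.  Scheduler and controller use the same recursion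
  and differ only in the reading \<open>\<rho>\<close> that their information provides.
\<close>

function
  deviation :: "'a control_problem \<Rightarrow> control_policy \<Rightarrow> (nat \<Rightarrow> real \<Rightarrow> real) \<Rightarrow> (nat \<Rightarrow> real) \<Rightarrow> nat \<Rightarrow> real" and
  replay_obs :: "'a control_problem \<Rightarrow> control_policy \<Rightarrow> (nat \<Rightarrow> real \<Rightarrow> real) \<Rightarrow> (nat \<Rightarrow> real) \<Rightarrow> nat \<Rightarrow> real" and
  replay_ctrl :: "'a control_problem \<Rightarrow> control_policy \<Rightarrow> (nat \<Rightarrow> real \<Rightarrow> real) \<Rightarrow> (nat \<Rightarrow> real) \<Rightarrow> nat \<Rightarrow> real"
where
  "deviation S \<mu> \<rho> u 0 = 0"
| "deviation S \<mu> \<rho> u (Suc k) =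
     coeff_a S * deviation S \<mu> \<rho> u k + coeff_b S * (u k - replay_ctrl S \<mu> \<rho> u k)"
| "replay_obs S \<mu> \<rho> u k =
     (if delay S \<le> k then \<rho> (k - delay S) (deviation S \<mu> \<rho> u (k - delay S)) else 0)"
| "replay_ctrl S \<mu> \<rho> u k =
     \<mu> k (\<lambda>i\<in>{..k}. replay_obs S \<mu> \<rho> u i, \<lambda>i\<in>{..<k}. replay_ctrl S \<mu> \<rho> u i)"
  by pat_completeness auto
termination
  by (relation "Wellfounded.measure (case_sum
        (\<lambda>(S, \<mu>, \<rho>, u, k). 4 * k)
        (case_sum (\<lambda>(S, \<mu>, \<rho>, u, k). 4 * k + 2) (\<lambda>(S, \<mu>, \<rho>, u, k). 4 * k + 3)))")
     auto

declare deviation.simps [simp del] replay_obs.simps [simp del] replay_ctrl.simps [simp del]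

definition replay_info ::
    "'a control_problem \<Rightarrow> control_policy \<Rightarrow> (nat \<Rightarrow> real \<Rightarrow> real) \<Rightarrow> (nat \<Rightarrow> real) \<Rightarrow> nat \<Rightarrow>
      (nat \<Rightarrow> real) \<times> (nat \<Rightarrow> real)" where
  "replay_info S \<mu> \<rho> u k =
     (\<lambda>i\<in>{..k}. replay_obs S \<mu> \<rho> u i, \<lambda>i\<in>{..<k}. replay_ctrl S \<mu> \<rho> u i)"

lemma replay_ctrl_eq: "replay_ctrl S \<mu> \<rho> u k = \<mu> k (replay_info S \<mu> \<rho> u k)"
  unfolding replay_info_def by (rule replay_ctrl.simps)

text \<open>
  Because of the delay, the simulation up to time \<open>k\<close> only needs correct readings of transmissions
  that have arrived by time \<open>k\<close>.
\<close>

lemma replay_correct: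
  assumes u: "\<And>i. i < k \<Longrightarrow> u i = v i"
    and \<rho>: "\<And>j. j + delay S \<le> k \<Longrightarrow> \<rho> j (\<Delta> j) = sched S \<pi> \<mu> j \<omega> * state S \<pi> \<mu> j \<omega>"
    and \<Delta>: "\<Delta> 0 = 0" "\<And>i. \<Delta> (Suc i) = coeff_a S * \<Delta> i + coeff_b S * (v i - ctrl S \<pi> \<mu> i \<omega>)"
    and "i \<le> k"
  shows "deviation S \<mu> \<rho> u i = \<Delta> i" "replay_obs S \<mu> \<rho> u i = obs S \<pi> \<mu> i \<omega>"
    "replay_ctrl S \<mu> \<rho> u i = ctrl S \<pi> \<mu> i \<omega>"
proof -
  have "deviation S \<mu> \<rho> u i = \<Delta> i \<and> replay_obs S \<mu> \<rho> u i = obs S \<pi> \<mu> i \<omega> \<and>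
    replay_ctrl S \<mu> \<rho> u i = ctrl S \<pi> \<mu> i \<omega>"
    using \<open>i \<le> k\<close>
  proof (induction i rule: less_induct)
    case (less i)
    have past: "deviation S \<mu> \<rho> u j = \<Delta> j" "replay_obs S \<mu> \<rho> u j = obs S \<pi> \<mu> j \<omega>"
      "replay_ctrl S \<mu> \<rho> u j = ctrl S \<pi> \<mu> j \<omega>" if "j < i" for j
      using less.IH[OF that] less.prems that by auto
    have dev: "deviation S \<mu> \<rho> u i = \<Delta> i"
    proof (cases i)
      case 0
      then show ?thesis by (simp add: deviation.simps \<Delta>)
    next
      case (Suc j)
      then show ?thesis using past[of j] u[of j] less.prems by (simp add: deviation.simps \<Delta>)
    qed
    have dev': "deviation S \<mu> \<rho> u j = \<Delta> j" if "j \<le> i" for j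
      using that past dev by (cases "j = i") auto
    have obs: "replay_obs S \<mu> \<rho> u i = obs S \<pi> \<mu> i \<omega>"
      unfolding replay_obs.simps[of S \<mu> \<rho> u i] obs_eq using less.prems
      by (auto simp: dev' \<rho>)
    have obs': "replay_obs S \<mu> \<rho> u j = obs S \<pi> \<mu> j \<omega>" if "j \<le> i" for j
      using that past obs by (cases "j = i") auto
    have "replay_info S \<mu> \<rho> u i = control_info S \<pi> \<mu> i \<omega>"
      unfolding replay_info_def control_info_def using past obs' by (auto intro!: restrict_ext)
    then have "replay_ctrl S \<mu> \<rho> u i = ctrl S \<pi> \<mu> i \<omega>"
      by (simp add: replay_ctrl_eq ctrl_eq_control_info)
    with dev obs show ?case by simp
  qed
  then show "deviation S \<mu> \<rho> u i = \<Delta> i" "replay_obs S \<mu> \<rho> u i = obs S \<pi> \<mu> i \<omega>"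
    "replay_ctrl S \<mu> \<rho> u i = ctrl S \<pi> \<mu> i \<omega>" by auto
qed

text \<open>Here \<open>h\<close> stands for the history from which readings and inputs are taken.\<close>

lemma replay_measurable:
  assumes mu: "\<mu> \<in> control_policies"
    and \<rho>: "\<And>j. j + delay S \<le> k \<Longrightarrow> (\<lambda>(h, z). \<rho> h j z) \<in> borel_measurable (M \<Otimes>\<^sub>M borel)"
    and u: "\<And>j. j < k \<Longrightarrow> (\<lambda>h. u h j) \<in> borel_measurable M"
    and "i \<le> k"
  shows "(\<lambda>h. deviation S \<mu> (\<rho> h) (u h) i) \<in> borel_measurable M"
    "(\<lambda>h. replay_obs S \<mu> (\<rho> h) (u h) i) \<in> borel_measurable M"
    "(\<lambda>h. replay_ctrl S \<mu> (\<rho> h) (u h) i) \<in> borel_measurable M"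
proof -
  have "(\<lambda>h. deviation S \<mu> (\<rho> h) (u h) i) \<in> borel_measurable M \<and>
    (\<lambda>h. replay_obs S \<mu> (\<rho> h) (u h) i) \<in> borel_measurable M \<and>
    (\<lambda>h. replay_ctrl S \<mu> (\<rho> h) (u h) i) \<in> borel_measurable M"
    using \<open>i \<le> k\<close>
  proof (induction i rule: less_induct)
    case (less i)
    have past: "(\<lambda>h. deviation S \<mu> (\<rho> h) (u h) j) \<in> borel_measurable M"
      "(\<lambda>h. replay_obs S \<mu> (\<rho> h) (u h) j) \<in> borel_measurable M"
      "(\<lambda>h. replay_ctrl S \<mu> (\<rho> h) (u h) j) \<in> borel_measurable M" if "j < i" for j
      using less.IH[OF that] less.prems that by auto
    have dev: "(\<lambda>h. deviation S \<mu> (\<rho> h) (u h) i) \<in> borel_measurable M"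
    proof (cases i)
      case 0
      then show ?thesis by (simp add: deviation.simps)
    next
      case (Suc j)
      then have [measurable]: "(\<lambda>h. deviation S \<mu> (\<rho> h) (u h) j) \<in> borel_measurable M"
        "(\<lambda>h. replay_ctrl S \<mu> (\<rho> h) (u h) j) \<in> borel_measurable M"
        "(\<lambda>h. u h j) \<in> borel_measurable M"
        using past u less.prems by auto
      show ?thesis unfolding Suc deviation.simps by measurable
    qed
    have dev': "(\<lambda>h. deviation S \<mu> (\<rho> h) (u h) j) \<in> borel_measurable M" if "j \<le> i" for j
      using that past dev by (cases "j = i") auto
    have obs: "(\<lambda>h. replay_obs S \<mu> (\<rho> h) (u h) i) \<in> borel_measurable M"
    proof (cases "delay S \<le> i")
      case True
      let ?j = "i - delay S"
      have "(\<lambda>h. (h, deviation S \<mu> (\<rho> h) (u h) ?j)) \<in> measurable M (M \<Otimes>\<^sub>M borel)"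
        using dev' by (intro measurable_Pair) auto
      from measurable_compose[OF this \<rho>[of ?j]] show ?thesis
        using True less.prems by (subst replay_obs.simps) simp
    qed (subst replay_obs.simps, simp)
    have obs': "(\<lambda>h. replay_obs S \<mu> (\<rho> h) (u h) j) \<in> borel_measurable M" if "j \<le> i" for j
      using that past obs by (cases "j = i") auto
    have "(\<lambda>h. replay_info S \<mu> (\<rho> h) (u h) i) \<in> measurable M (control_info_space i)"
      unfolding control_info_space_def replay_info_def
      by (intro measurable_Pair measurable_restrict) (auto intro: obs' past)
    moreover have "\<mu> i \<in> borel_measurable (control_info_space i)"
      using mu by (auto simp: control_policies_def)
    ultimately have "(\<lambda>h. replay_ctrl S \<mu> (\<rho> h) (u h) i) \<in> borel_measurable M"
      unfolding replay_ctrl_eq by (rule measurable_compose)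
    with dev obs show ?case by simp
  qed
  then show "(\<lambda>h. deviation S \<mu> (\<rho> h) (u h) i) \<in> borel_measurable M"
    "(\<lambda>h. replay_obs S \<mu> (\<rho> h) (u h) i) \<in> borel_measurable M"
    "(\<lambda>h. replay_ctrl S \<mu> (\<rho> h) (u h) i) \<in> borel_measurable M" by auto
qed

lemma sched_info_coordinates:
  shows "i \<le> k \<Longrightarrow> (\<lambda>h. fst h i) \<in> borel_measurable (sched_info_space k)"
    "i < k \<Longrightarrow> (\<lambda>h. fst (snd h) i) \<in> borel_measurable (sched_info_space k)"
    "i < k \<Longrightarrow> (\<lambda>h. snd (snd h) i) \<in> borel_measurable (sched_info_space k)"
  unfolding sched_info_space_def by measurable

lemma control_info_coordinates:
  shows "i \<le> k \<Longrightarrow> (\<lambda>h. fst h i) \<in> borel_measurable (control_info_space k)"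
    "i < k \<Longrightarrow> (\<lambda>h. snd h i) \<in> borel_measurable (control_info_space k)"
  unfolding control_info_space_def by measurable

section \<open>A competitor that imitates the information of a given loop\<close>

locale reference_loop = lq_system S for S :: "'a control_problem" +
  fixes \<pi> :: sched_policy and \<mu> :: control_policy
  assumes adm: "admissible S \<pi> \<mu>"
begin

lemma policies: "\<pi> \<in> sched_policies" "\<mu> \<in> control_policies"
  using adm by (auto simp: admissible_def)

abbreviation estimate :: "nat \<Rightarrow> 'a \<Rightarrow> real" where
  "estimate \<equiv> state_estimate S \<pi> \<mu>"

lemma finite_measure_subalgebra_control_info:
  "finite_measure_subalgebra (base S) (control_info_algebra S \<pi> \<mu> k)"
  unfolding control_info_algebra_def
  by unfold_locales (rule subalgebra_vimage_algebra[OF control_info_measurable[OF policies]])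

lemma ctrl_info_measurable: "ctrl S \<pi> \<mu> k \<in> borel_measurable (control_info_algebra S \<pi> \<mu> k)"
  unfolding ctrl_eq_control_info control_info_algebra_def
proof (rule measurable_compose[OF measurable_vimage_algebra1])
  show "\<mu> k \<in> borel_measurable (control_info_space k)"
    using policies by (auto simp: control_policies_def)
qed (auto intro: control_info_in_space)

lemma estimate_L2: "k \<le> horizon S \<Longrightarrow> square_integrable (base S) (estimate k)"
  unfolding state_estimate_def
  by (rule finite_measure_subalgebra.square_integrable_cond_exp[OF
        finite_measure_subalgebra_control_info admissible_L2(2)[OF adm]])

lemma estimate_measurable: "estimate k \<in> borel_measurable (base S)"
  unfolding state_estimate_def by simp

text \<open>
  The estimate as a function of realised information, so that the competitor's controller can
  evaluate it at the replayed information.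
\<close>

definition estimator :: "nat \<Rightarrow> (nat \<Rightarrow> real) \<times> (nat \<Rightarrow> real) \<Rightarrow> real" where
  "estimator k = (SOME g. g \<in> borel_measurable (control_info_space k) \<and>
     (\<forall>\<omega>\<in>space (base S). estimate k \<omega> = g (control_info S \<pi> \<mu> k \<omega>)))"

lemma estimator:
  "estimator k \<in> borel_measurable (control_info_space k)"
  "\<omega> \<in> space (base S) \<Longrightarrow> estimate k \<omega> = estimator k (control_info S \<pi> \<mu> k \<omega>)"
proof -
  have "\<exists>g\<in>borel_measurable (control_info_space k).
      \<forall>\<omega>\<in>space (base S). estimate k \<omega> = g (control_info S \<pi> \<mu> k \<omega>)"
    by (rule vimage_algebra_factorization)
      (auto simp: state_estimate_def control_info_algebra_def control_info_in_space)
  then have "\<exists>g. g \<in> borel_measurable (control_info_space k) \<and>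
      (\<forall>\<omega>\<in>space (base S). estimate k \<omega> = g (control_info S \<pi> \<mu> k \<omega>))" by blast
  from someI_ex[OF this]
  show "estimator k \<in> borel_measurable (control_info_space k)"
    "\<omega> \<in> space (base S) \<Longrightarrow> estimate k \<omega> = estimator k (control_info S \<pi> \<mu> k \<omega>)"
    unfolding estimator_def by auto
qed

text \<open>
  The dither solves \<open>s (k + 1) = (a - b * L k) * s k + b * \<epsilon> * dither k\<close> for \<open>s 0 = 0\<close> and \<open>s k = \<epsilon>\<close>
  at all later times; this \<open>s\<close> is its effect on the state.  If \<open>coeff_b S = 0\<close> then inputs do not
  move the state, and division by zero conveniently switches the dither off.
\<close>

definition dither :: "nat \<Rightarrow> real" where
  "dither k = (if k = 0 then 1 else 1 - coeff_a S + coeff_b S * gain S k) / coeff_b S"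

text \<open>The intended difference between the competitor's state and the reference state.\<close>

primrec shift :: "real \<Rightarrow> nat \<Rightarrow> 'a \<Rightarrow> real" where
  "shift \<epsilon> 0 \<omega> = 0"
| "shift \<epsilon> (Suc k) \<omega> = coeff_a S * shift \<epsilon> k \<omega> +
     coeff_b S * (- gain S k * (estimate k \<omega> + shift \<epsilon> k \<omega>) + \<epsilon> * dither k - ctrl S \<pi> \<mu> k \<omega>)"

definition intended_ctrl :: "real \<Rightarrow> nat \<Rightarrow> 'a \<Rightarrow> real" where
  "intended_ctrl \<epsilon> k \<omega> = - gain S k * (estimate k \<omega> + shift \<epsilon> k \<omega>) + \<epsilon> * dither k"

lemma shift_Suc: "shift \<epsilon> (Suc k) \<omega> = coeff_a S * shift \<epsilon> k \<omega> +
    coeff_b S * (intended_ctrl \<epsilon> k \<omega> - ctrl S \<pi> \<mu> k \<omega>)"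
  by (simp add: intended_ctrl_def)

lemma shift_no_input: "coeff_b S = 0 \<Longrightarrow> shift \<epsilon> k \<omega> = 0"
  by (induction k) auto

lemma shift_dither:
  assumes "coeff_b S \<noteq> 0"
  shows "shift \<epsilon> (Suc k) \<omega> = shift 0 (Suc k) \<omega> + \<epsilon>"
proof (induction k)
  case (Suc k)
  have "coeff_b S * dither (Suc k) = 1 - coeff_a S + coeff_b S * gain S (Suc k)"
    using assms by (simp add: dither_def)
  then have *: "coeff_b S * (\<epsilon> * dither (Suc k)) = \<epsilon> * (1 - coeff_a S + coeff_b S * gain S (Suc k))"
    by (metis mult.left_commute)
  show ?case
    unfolding shift.simps(2)[of _ "Suc k"] unfolding Suc
    using * by (simp add: algebra_simps)
qed (use assms in \<open>simp add: dither_def algebra_simps\<close>)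

lemma shift_measurable [measurable]: "shift \<epsilon> k \<in> borel_measurable (base S)"
proof (induction k)
  case (Suc k)
  note [measurable] = Suc estimate_measurable measurable_base(4)[OF policies]
  show ?case unfolding shift.simps(2)[abs_def] by measurable
qed (simp add: shift.simps(1)[abs_def])

lemma shift_L2: "k \<le> horizon S \<Longrightarrow> square_integrable (base S) (shift \<epsilon> k)"
proof (induction k)
  case 0
  then show ?case by (simp add: shift.simps(1)[abs_def] square_integrable_const)
next
  case (Suc k)
  then show ?case unfolding shift.simps(2)[abs_def]
    by (intro square_integrable_add square_integrable_diff square_integrable_cmult
        square_integrable_const estimate_L2 admissible_L2(1)[OF adm]) auto
qed

lemma intended_ctrl_L2: "k < horizon S \<Longrightarrow> square_integrable (base S) (intended_ctrl \<epsilon> k)"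
  unfolding intended_ctrl_def[abs_def]
  by (intro square_integrable_add square_integrable_cmult square_integrable_const
      estimate_L2 shift_L2) auto

text \<open>
  The scheduler sees decisions and states, so it recovers the reference transmissions exactly.  The
  controller sees only \<open>D j * X j\<close> and takes a zero to mean silence.
\<close>

definition sched_reading :: "(nat \<Rightarrow> real) \<times> (nat \<Rightarrow> real) \<times> (nat \<Rightarrow> real) \<Rightarrow> nat \<Rightarrow> real \<Rightarrow> real" where
  "sched_reading h j z = fst (snd h) j * (fst h j - z)"

definition control_reading :: "(nat \<Rightarrow> real) \<times> (nat \<Rightarrow> real) \<Rightarrow> nat \<Rightarrow> real \<Rightarrow> real" where
  "control_reading h j z = (if fst h (j + delay S) = 0 then 0 else fst h (j + delay S) - z)"

definition competitor_sched :: sched_policy where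
  "competitor_sched k h = \<pi> k
     (\<lambda>i\<in>{..k}. fst h i - deviation S \<mu> (sched_reading h) (snd (snd h)) i,
      \<lambda>i\<in>{..<k}. fst (snd h) i,
      \<lambda>i\<in>{..<k}. replay_ctrl S \<mu> (sched_reading h) (snd (snd h)) i)"

text \<open>
  The reference estimate corrected by the known deviation estimates the competitor's state with
  the reference error.
\<close>

definition competitor_ctrl :: "real \<Rightarrow> control_policy" where
  "competitor_ctrl \<epsilon> k h = - gain S k *
     (estimator k (replay_info S \<mu> (control_reading h) (snd h) k)
       + deviation S \<mu> (control_reading h) (snd h) k) + \<epsilon> * dither k"

lemma competitor_sched_policy: "competitor_sched \<in> sched_policies"
  unfolding sched_policies_def
proof (intro CollectI allI conjI ballI)
  fix k
  have \<pi>: "\<pi> k \<in> borel_measurable (sched_info_space k)" "h \<in> space (sched_info_space k) \<Longrightarrow> \<pi> k h \<in> {0, 1}" for h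
    using policies(1) by (auto simp: sched_policies_def)
  note coord = sched_info_coordinates[of _ k]
  have "(\<lambda>(h, z). sched_reading h j z) \<in> borel_measurable (sched_info_space k \<Otimes>\<^sub>M borel)"
    if "j + delay S \<le> k" for j
  proof -
    have [measurable]: "(\<lambda>h. fst h j) \<in> borel_measurable (sched_info_space k)"
      "(\<lambda>h. fst (snd h) j) \<in> borel_measurable (sched_info_space k)"
      using that delay_pos by (auto intro: coord)
    show ?thesis unfolding sched_reading_def by measurable
  qed
  note replay = replay_measurable[OF policies(2) this coord(3)]
  have "(\<lambda>h. (\<lambda>i\<in>{..k}. fst h i - deviation S \<mu> (sched_reading h) (snd (snd h)) i,
      \<lambda>i\<in>{..<k}. fst (snd h) i,
      \<lambda>i\<in>{..<k}. replay_ctrl S \<mu> (sched_reading h) (snd (snd h)) i))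
    \<in> measurable (sched_info_space k) (sched_info_space k)" (is "?r \<in> _")
    by (subst (2) sched_info_space_def)
      (auto intro!: measurable_Pair measurable_restrict borel_measurable_diff coord replay)
  then show "competitor_sched k \<in> borel_measurable (sched_info_space k)"
    unfolding competitor_sched_def[abs_def] by (rule measurable_compose[OF _ \<pi>(1)])
  show "competitor_sched k h \<in> {0, 1}" if "h \<in> space (sched_info_space k)" for h
    unfolding competitor_sched_def
    by (rule \<pi>(2)) (auto simp: sched_info_space_def space_pair_measure intro: in_space_PiM_borel)
qed

lemma competitor_ctrl_policy: "competitor_ctrl \<epsilon> \<in> control_policies"
  unfolding control_policies_def
proof (intro CollectI allI)
  fix k
  note coord = control_info_coordinates[of _ k]
  have "(\<lambda>(h, z). control_reading h j z) \<in> borel_measurable (control_info_space k \<Otimes>\<^sub>M borel)"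
    if "j + delay S \<le> k" for j
  proof -
    have [measurable]: "(\<lambda>h. fst h (j + delay S)) \<in> borel_measurable (control_info_space k)"
      using that by (auto intro: coord)
    show ?thesis unfolding control_reading_def by measurable
  qed
  note replay = replay_measurable[OF policies(2) this coord(2)]
  have "(\<lambda>h. replay_info S \<mu> (control_reading h) (snd h) k)
      \<in> measurable (control_info_space k) (control_info_space k)"
    unfolding replay_info_def
    by (subst (2) control_info_space_def) (auto intro!: measurable_Pair measurable_restrict replay)
  note [measurable] = measurable_compose[OF this estimator(1)] replay(1)[OF _ _ order.refl]
  show "competitor_ctrl \<epsilon> k \<in> borel_measurable (control_info_space k)"
    unfolding competitor_ctrl_def[abs_def] by measurable
qed

text \<open>
  The controller misreads a transmission as silence exactly when the competitor's state vanishes.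
  Where the shift is \<open>0\<close> the reference controller misses the same transmission, so no harm is done.
\<close>

lemma competitor_loop:
  assumes \<omega>: "\<omega> \<in> space (base S)"
    and visible: "\<forall>k. state S \<pi> \<mu> k \<omega> + shift \<epsilon> k \<omega> \<noteq> 0 \<or> shift \<epsilon> k \<omega> = 0"
  shows "state S competitor_sched (competitor_ctrl \<epsilon>) k \<omega> = state S \<pi> \<mu> k \<omega> + shift \<epsilon> k \<omega>"
    "sched S competitor_sched (competitor_ctrl \<epsilon>) k \<omega> = sched S \<pi> \<mu> k \<omega>"
    "ctrl S competitor_sched (competitor_ctrl \<epsilon>) k \<omega> = intended_ctrl \<epsilon> k \<omega>"
proof -
  let ?X = "state S \<pi> \<mu>" and ?D = "sched S \<pi> \<mu>" and ?U = "ctrl S \<pi> \<mu>"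
  let ?p = "competitor_sched" and ?m = "competitor_ctrl \<epsilon>"
  have "state S ?p ?m k \<omega> = ?X k \<omega> + shift \<epsilon> k \<omega> \<and> sched S ?p ?m k \<omega> = ?D k \<omega> \<and>
    ctrl S ?p ?m k \<omega> = intended_ctrl \<epsilon> k \<omega>"
  proof (induction k rule: less_induct)
    case (less k)
    have X: "state S ?p ?m k \<omega> = ?X k \<omega> + shift \<epsilon> k \<omega>"
    proof (cases k)
      case 0
      then show ?thesis by (simp add: state.simps)
    next
      case (Suc j)
      then show ?thesis using less.IH[of j] by (simp add: state.simps shift_Suc algebra_simps del: shift.simps(2))
    qed
    have X': "state S ?p ?m i \<omega> = ?X i \<omega> + shift \<epsilon> i \<omega>" if "i \<le> k" for i
      using that less.IH[of i] X by (cases "i = k") auto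
    have D: "sched S ?p ?m k \<omega> = ?D k \<omega>"
    proof -
      define h where "h = sched_info S ?p ?m k \<omega>"
      have h: "\<And>i. i \<le> k \<Longrightarrow> fst h i = ?X i \<omega> + shift \<epsilon> i \<omega>"
        "\<And>i. i < k \<Longrightarrow> fst (snd h) i = ?D i \<omega>" "\<And>i. i < k \<Longrightarrow> snd (snd h) i = intended_ctrl \<epsilon> i \<omega>"
        unfolding h_def sched_info_def using X' less.IH by auto
      have reading: "sched_reading h j (shift \<epsilon> j \<omega>) = ?D j \<omega> * ?X j \<omega>" if "j + delay S \<le> k" for j
        using that delay_pos by (simp add: sched_reading_def h)
      note replay = replay_correct[where \<Delta>="\<lambda>i. shift \<epsilon> i \<omega>" and \<rho>="sched_reading h" and u="snd (snd h)"
          and v="\<lambda>i. intended_ctrl \<epsilon> i \<omega>", OF h(3) reading shift.simps(1) shift_Suc]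
      have "(\<lambda>i\<in>{..k}. fst h i - deviation S \<mu> (sched_reading h) (snd (snd h)) i,
          \<lambda>i\<in>{..<k}. fst (snd h) i,
          \<lambda>i\<in>{..<k}. replay_ctrl S \<mu> (sched_reading h) (snd (snd h)) i) = sched_info S \<pi> \<mu> k \<omega>"
        unfolding sched_info_def by (auto intro!: restrict_ext simp: h replay)
      then show ?thesis
        by (simp add: sched_eq_sched_info competitor_sched_def h_def[symmetric])
    qed
    have D': "sched S ?p ?m i \<omega> = ?D i \<omega>" if "i \<le> k" for i
      using that less.IH[of i] D by (cases "i = k") auto
    have U: "ctrl S ?p ?m k \<omega> = intended_ctrl \<epsilon> k \<omega>"
    proof -
      define h where "h = control_info S ?p ?m k \<omega>"
      have h: "\<And>i. i \<le> k \<Longrightarrow> fst h i = obs S ?p ?m i \<omega>"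
        "\<And>i. i < k \<Longrightarrow> snd h i = intended_ctrl \<epsilon> i \<omega>"
        unfolding h_def control_info_def using less.IH by auto
      have reading: "control_reading h j (shift \<epsilon> j \<omega>) = ?D j \<omega> * ?X j \<omega>" if "j + delay S \<le> k" for j
      proof -
        have "fst h (j + delay S) = ?D j \<omega> * (?X j \<omega> + shift \<epsilon> j \<omega>)"
          using that by (simp add: h obs_eq X' D')
        then show ?thesis
          using sched_0_1[OF policies(1), of S \<mu> j \<omega>] visible[rule_format, of j] by (auto simp: control_reading_def)
      qed
      note replay = replay_correct[where \<Delta>="\<lambda>i. shift \<epsilon> i \<omega>" and \<rho>="control_reading h" and u="snd h"
          and v="\<lambda>i. intended_ctrl \<epsilon> i \<omega>", OF h(2) reading shift.simps(1) shift_Suc]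
      have "replay_info S \<mu> (control_reading h) (snd h) k = control_info S \<pi> \<mu> k \<omega>"
        unfolding replay_info_def control_info_def by (auto intro!: restrict_ext simp: replay)
      then show ?thesis
        by (simp add: ctrl_eq_control_info[of S ?p] competitor_ctrl_def h_def[symmetric] replay
            estimator(2)[OF \<omega>] intended_ctrl_def)
    qed
    from X D U show ?case by simp
  qed
  then show "state S ?p ?m k \<omega> = ?X k \<omega> + shift \<epsilon> k \<omega>" "sched S ?p ?m k \<omega> = ?D k \<omega>"
    "ctrl S ?p ?m k \<omega> = intended_ctrl \<epsilon> k \<omega>" by auto
qed

text \<open>
  A distribution has countably many atoms, so only countably many displacements put an atom of some
  state at zero.
\<close>

lemma generic_dither_visible:
  "\<exists>C. countable C \<and> (\<forall>\<epsilon>. \<epsilon> \<notin> C \<longrightarrow> (AE \<omega> in base S. \<forall>k.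
     state S \<pi> \<mu> k \<omega> + shift \<epsilon> k \<omega> \<noteq> 0 \<or> shift \<epsilon> k \<omega> = 0))"
proof -
  define Y where "Y k \<omega> = state S \<pi> \<mu> k \<omega> + shift 0 k \<omega>" for k \<omega>
  note [measurable] = measurable_base(1)[OF policies]
  have Y [measurable]: "Y k \<in> borel_measurable (base S)" for k
    unfolding Y_def[abs_def] by measurable
  define C where "C = (\<Union>k. uminus ` {x. measure (distr (base S) borel (Y k)) {x} \<noteq> 0})"
  have "countable {x. measure (distr (base S) borel (Y k)) {x} \<noteq> 0}" for k
    by (rule finite_measure.countable_support[OF finite_measure_distr[OF Y]])
  then have "countable C" unfolding C_def by auto
  moreover have "AE \<omega> in base S. \<forall>k. state S \<pi> \<mu> k \<omega> + shift \<epsilon> k \<omega> \<noteq> 0 \<or> shift \<epsilon> k \<omega> = 0"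
    if "\<epsilon> \<notin> C" for \<epsilon>
    unfolding AE_all_countable
  proof
    fix k
    have "prob {\<omega>\<in>space (base S). Y k \<omega> = - \<epsilon>} = 0"
    proof -
      have "measure (distr (base S) borel (Y k)) {- \<epsilon>} = 0"
        using that unfolding C_def by (force simp: image_iff)
      moreover have "Y k -` {- \<epsilon>} \<inter> space (base S) = {\<omega>\<in>space (base S). Y k \<omega> = - \<epsilon>}" by auto
      ultimately show ?thesis by (simp add: measure_distr)
    qed
    then have "AE \<omega> in base S. Y k \<omega> \<noteq> - \<epsilon>"
      by (subst (asm) prob_eq_0) auto
    then show "AE \<omega> in base S. state S \<pi> \<mu> k \<omega> + shift \<epsilon> k \<omega> \<noteq> 0 \<or> shift \<epsilon> k \<omega> = 0"
    proof (rule AE_mp, intro AE_I2 impI)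
      fix \<omega> assume Y_ne: "Y k \<omega> \<noteq> - \<epsilon>"
      show "state S \<pi> \<mu> k \<omega> + shift \<epsilon> k \<omega> \<noteq> 0 \<or> shift \<epsilon> k \<omega> = 0"
      proof (cases "k = 0 \<or> coeff_b S = 0")
        case True
        then show ?thesis using shift_no_input by auto
      next
        case False
        then obtain j where "k = Suc j" by (cases k) auto
        then show ?thesis
          using False Y_ne shift_dither[of \<epsilon> j \<omega>] by (auto simp: Y_def simp del: shift.simps)
      qed
    qed
  qed
  ultimately show ?thesis by blast
qed

lemma competitor_admissible:
  assumes visible: "AE \<omega> in base S. \<forall>k. state S \<pi> \<mu> k \<omega> + shift \<epsilon> k \<omega> \<noteq> 0 \<or> shift \<epsilon> k \<omega> = 0"
  shows "admissible S competitor_sched (competitor_ctrl \<epsilon>)"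
  unfolding admissible_def
proof (intro conjI allI impI competitor_sched_policy competitor_ctrl_policy)
  fix k assume k: "k < horizon S"
  note [measurable] = measurable_base(4)[OF competitor_sched_policy competitor_ctrl_policy]
    square_integrableD(1)[OF intended_ctrl_L2[OF k]]
  have "AE \<omega> in base S. ctrl S competitor_sched (competitor_ctrl \<epsilon>) k \<omega> = intended_ctrl \<epsilon> k \<omega>"
    using visible AE_space by eventually_elim (rule competitor_loop(3))
  then have "AE \<omega> in base S. (ctrl S competitor_sched (competitor_ctrl \<epsilon>) k \<omega>)\<^sup>2 = (intended_ctrl \<epsilon> k \<omega>)\<^sup>2"
    by eventually_elim simp
  then show "integrable (base S) (\<lambda>\<omega>. (ctrl S competitor_sched (competitor_ctrl \<epsilon>) k \<omega>)\<^sup>2)"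
    using square_integrableD(2)[OF intended_ctrl_L2[OF k]]
    by (subst integrable_cong_AE) auto
qed

lemma competitor_feasible:
  assumes visible: "AE \<omega> in base S. \<forall>k. state S \<pi> \<mu> k \<omega> + shift \<epsilon> k \<omega> \<noteq> 0 \<or> shift \<epsilon> k \<omega> = 0"
    and feasible: "feasible S \<pi> \<mu>"
  shows "feasible S competitor_sched (competitor_ctrl \<epsilon>)"
proof -
  have "AE \<omega> in base S. 1 / real (horizon S) * (\<Sum>k<horizon S. sched S \<pi> \<mu> k \<omega>) \<le> rate S"
    using feasible by (auto simp: feasible_def)
  then have "AE \<omega> in base S. 1 / real (horizon S) *
      (\<Sum>k<horizon S. sched S competitor_sched (competitor_ctrl \<epsilon>) k \<omega>) \<le> rate S"
    using visible AE_space by eventually_elim (simp add: competitor_loop(2))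
  then show ?thesis
    using competitor_admissible[OF visible] by (simp add: feasible_def)
qed

definition estimation_error :: "nat \<Rightarrow> real" where
  "estimation_error k = (LINT \<omega>|base S. (state S \<pi> \<mu> k \<omega> - estimate k \<omega>)\<^sup>2)"

text \<open>
  The input deviates from the linear law for the true state by the dither plus a multiple of the
  reference estimation error; the latter has mean zero, so the two do not correlate.
\<close>

lemma competitor_square:
  assumes visible: "AE \<omega> in base S. \<forall>k. state S \<pi> \<mu> k \<omega> + shift \<epsilon> k \<omega> \<noteq> 0 \<or> shift \<epsilon> k \<omega> = 0"
    and k: "k < horizon S"
  shows "(LINT \<omega>|base S. (ctrl S competitor_sched (competitor_ctrl \<epsilon>) k \<omega>
       + gain S k * state S competitor_sched (competitor_ctrl \<epsilon>) k \<omega>)\<^sup>2) =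
     \<epsilon>\<^sup>2 * (dither k)\<^sup>2 + (gain S k)\<^sup>2 * estimation_error k"
proof -
  interpret I: finite_measure_subalgebra "base S" "control_info_algebra S \<pi> \<mu> k"
    by (rule finite_measure_subalgebra_control_info)
  have X: "square_integrable (base S) (state S \<pi> \<mu> k)"
    using k by (intro admissible_L2(2)[OF adm]) simp
  define e where "e \<omega> = state S \<pi> \<mu> k \<omega> - estimate k \<omega>" for \<omega>
  have e: "square_integrable (base S) e"
    unfolding e_def[abs_def] using k by (intro square_integrable_diff X estimate_L2) simp
  have "(LINT \<omega>|base S. estimate k \<omega>) = (LINT \<omega>|base S. state S \<pi> \<mu> k \<omega>)"
    unfolding state_estimate_def by (rule I.real_cond_exp_int(2)[OF square_integrable_integrable[OF X]])
  then have e0: "(LINT \<omega>|base S. e \<omega>) = 0"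
    unfolding e_def using k square_integrable_integrable[OF X] square_integrable_integrable[OF estimate_L2[of k]]
    by simp
  note [measurable] = measurable_base(1,4)[OF competitor_sched_policy competitor_ctrl_policy]
    square_integrableD(1)[OF e]
  have "AE \<omega> in base S. ctrl S competitor_sched (competitor_ctrl \<epsilon>) k \<omega>
       + gain S k * state S competitor_sched (competitor_ctrl \<epsilon>) k \<omega> = \<epsilon> * dither k + gain S k * e \<omega>"
    using visible AE_space
    by eventually_elim (simp add: competitor_loop intended_ctrl_def e_def algebra_simps)
  then have "(LINT \<omega>|base S. (ctrl S competitor_sched (competitor_ctrl \<epsilon>) k \<omega>
       + gain S k * state S competitor_sched (competitor_ctrl \<epsilon>) k \<omega>)\<^sup>2) =
      (LINT \<omega>|base S. (\<epsilon> * dither k + gain S k * e \<omega>)\<^sup>2)"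
    by (intro integral_cong_AE) auto
  also have "\<dots> = (LINT \<omega>|base S. \<epsilon>\<^sup>2 * (dither k)\<^sup>2 + 2 * \<epsilon> * dither k * gain S k * e \<omega>
      + (gain S k)\<^sup>2 * (e \<omega>)\<^sup>2)"
    by (simp add: power2_eq_square algebra_simps)
  also have "\<dots> = \<epsilon>\<^sup>2 * (dither k)\<^sup>2 + (gain S k)\<^sup>2 * estimation_error k"
    using square_integrableD(2)[OF e] square_integrable_integrable[OF e] e0
    by (simp add: estimation_error_def e_def[symmetric] prob_space)
  finally show ?thesis .
qed

lemma reference_square:
  assumes k: "k < horizon S"
  shows "(LINT \<omega>|base S. (ctrl S \<pi> \<mu> k \<omega> + gain S k * state S \<pi> \<mu> k \<omega>)\<^sup>2) =
     (LINT \<omega>|base S. (ctrl S \<pi> \<mu> k \<omega> + gain S k * estimate k \<omega>)\<^sup>2) + (gain S k)\<^sup>2 * estimation_error k"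
  unfolding estimation_error_def state_estimate_def using k
  by (intro finite_measure_subalgebra.integral_sq_cond_exp_decomp
      finite_measure_subalgebra_control_info ctrl_info_measurable admissible_L2[OF adm]) auto

text \<open>
  The competitor has the estimation errors of the reference loop, so an optimal reference loop can
  lose against the certainty-equivalent law no more than the price of the dither, which vanishes
  with \<open>\<epsilon>\<close>.
\<close>

lemma optimal_certainty_equivalent:
  assumes opt: "optimal S \<pi> \<mu>" and k: "k < horizon S"
  shows "AE \<omega> in base S. ctrl S \<pi> \<mu> k \<omega> = - gain S k * estimate k \<omega>"
proof -
  define loss where "loss k = (LINT \<omega>|base S. (ctrl S \<pi> \<mu> k \<omega> + gain S k * estimate k \<omega>)\<^sup>2)" for k
  define A where "A = (\<Sum>k<horizon S. input_weight S k * loss k)"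
  define B where "B = (\<Sum>k<horizon S. input_weight S k * (dither k)\<^sup>2)"
  obtain C where "countable C" and C: "\<And>\<epsilon>. \<epsilon> \<notin> C \<Longrightarrow> AE \<omega> in base S. \<forall>k.
      state S \<pi> \<mu> k \<omega> + shift \<epsilon> k \<omega> \<noteq> 0 \<or> shift \<epsilon> k \<omega> = 0"
    using generic_dither_visible by blast
  have bound: "A \<le> \<epsilon>\<^sup>2 * B" if "\<epsilon> \<notin> C" for \<epsilon>
  proof -
    note visible = C[OF that]
    have "cost S \<pi> \<mu> \<le> cost S competitor_sched (competitor_ctrl \<epsilon>)"
      using opt competitor_feasible[OF visible] by (auto simp: optimal_def)
    then have "(\<Sum>k<horizon S. input_weight S k * (loss k + (gain S k)\<^sup>2 * estimation_error k)) \<le>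
        (\<Sum>k<horizon S. input_weight S k * (\<epsilon>\<^sup>2 * (dither k)\<^sup>2 + (gain S k)\<^sup>2 * estimation_error k))"
      unfolding cost_completed_squares[OF adm] cost_completed_squares[OF competitor_admissible[OF visible]]
      using k by (simp add: reference_square competitor_square[OF visible] loss_def divide_le_cancel)
    then have "A \<le> (\<Sum>k<horizon S. input_weight S k * (\<epsilon>\<^sup>2 * (dither k)\<^sup>2))"
      by (simp add: A_def distrib_left sum.distrib)
    also have "\<dots> = \<epsilon>\<^sup>2 * B"
      by (simp add: B_def sum_distrib_left mult.left_commute)
    finally show ?thesis .
  qed
  have loss_nonneg: "0 \<le> loss k" for k by (simp add: loss_def)
  have B: "0 \<le> B" unfolding B_def
    by (intro sum_nonneg mult_nonneg_nonneg less_imp_le[OF input_weight_pos]) simp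
  have "A \<le> 0"
  proof (rule ccontr)
    assume "\<not> A \<le> 0"
    then have A: "0 < A" by simp
    define \<delta> where "\<delta> = sqrt (A / (B + 1))"
    have \<delta>: "0 < \<delta>" using A B by (simp add: \<delta>_def)
    have "uncountable {0<..<\<delta>}" using uncountable_open_interval[of 0 \<delta>] \<delta> by simp
    then have "\<not> {0<..<\<delta>} \<subseteq> C"
      using \<open>countable C\<close> countable_subset by blast
    then obtain \<epsilon> where \<epsilon>: "0 < \<epsilon>" "\<epsilon> < \<delta>" "\<epsilon> \<notin> C"
      by (meson subsetI greaterThanLessThan_iff)
    have "\<epsilon>\<^sup>2 < \<delta>\<^sup>2" using \<epsilon> by (intro power_strict_mono) auto
    also have "\<dots> = A / (B + 1)" using A B by (simp add: \<delta>_def)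
    finally have "\<epsilon>\<^sup>2 * (B + 1) < A" using B by (simp add: field_simps)
    moreover have "\<epsilon>\<^sup>2 * B \<le> \<epsilon>\<^sup>2 * (B + 1)" by (simp add: mult_left_mono)
    ultimately show False using bound[OF \<epsilon>(3)] by simp
  qed
  moreover have terms: "0 \<le> input_weight S k * loss k" for k
    using loss_nonneg input_weight_pos[of k] by simp
  ultimately have "A = 0" unfolding A_def by (intro antisym sum_nonneg) auto
  then have "input_weight S k * loss k = 0"
    unfolding A_def using k terms by (subst (asm) sum_nonneg_eq_0_iff) auto
  then have "loss k = 0" using input_weight_pos[of k] by simp
  have "square_integrable (base S) (\<lambda>\<omega>. ctrl S \<pi> \<mu> k \<omega> + gain S k * estimate k \<omega>)"
    using k by (intro square_integrable_add square_integrable_cmult estimate_L2 admissible_L2(1)[OF adm]) auto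
  from square_integrableD(2)[OF this] \<open>loss k = 0\<close>
  have "AE \<omega> in base S. (ctrl S \<pi> \<mu> k \<omega> + gain S k * estimate k \<omega>)\<^sup>2 = 0"
    unfolding loss_def by (subst (asm) integral_nonneg_eq_0_iff_AE) auto
  then show ?thesis by eventually_elim (simp add: eq_neg_iff_add_eq_0)
qed

end

section \<open>Uniqueness of the certainty-equivalent loop\<close>

context lq_system
begin

abbreviation certainty_equivalent :: "sched_policy \<Rightarrow> control_policy \<Rightarrow> bool" where
  "certainty_equivalent \<pi> \<mu> \<equiv> \<forall>k<horizon S. AE \<omega> in base S.
     ctrl S \<pi> \<mu> k \<omega> = - gain S k * state_estimate S \<pi> \<mu> k \<omega>"

text \<open>
  With the scheduling policy fixed, the law determines the loop: the inputs before time \<open>k\<close> fix the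
  controller's information at time \<open>k\<close>, hence the estimate and the next input.
\<close>

lemma certainty_equivalent_loop_unique:
  assumes adm1: "admissible S \<pi> \<mu>1" and adm2: "admissible S \<pi> \<mu>2"
    and ce1: "certainty_equivalent \<pi> \<mu>1"
    and ce2: "certainty_equivalent \<pi> \<mu>2"
    and "n \<le> horizon S"
  shows "AE \<omega> in base S. (\<forall>i\<le>n. state S \<pi> \<mu>1 i \<omega> = state S \<pi> \<mu>2 i \<omega>) \<and>
    (\<forall>i<n. sched S \<pi> \<mu>1 i \<omega> = sched S \<pi> \<mu>2 i \<omega> \<and> obs S \<pi> \<mu>1 i \<omega> = obs S \<pi> \<mu>2 i \<omega> \<and>
      ctrl S \<pi> \<mu>1 i \<omega> = ctrl S \<pi> \<mu>2 i \<omega>)"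
  using \<open>n \<le> horizon S\<close>
proof (induction n)
  case 0
  then show ?case by (simp add: state.simps)
next
  case (Suc n)
  interpret L1: reference_loop S \<pi> \<mu>1 by unfold_locales (rule adm1)
  interpret L2: reference_loop S \<pi> \<mu>2 by unfold_locales (rule adm2)
  have n: "n < horizon S" using Suc.prems by simp
  have IH: "AE \<omega> in base S. (\<forall>i\<le>n. state S \<pi> \<mu>1 i \<omega> = state S \<pi> \<mu>2 i \<omega>) \<and>
    (\<forall>i<n. sched S \<pi> \<mu>1 i \<omega> = sched S \<pi> \<mu>2 i \<omega> \<and> obs S \<pi> \<mu>1 i \<omega> = obs S \<pi> \<mu>2 i \<omega> \<and>
      ctrl S \<pi> \<mu>1 i \<omega> = ctrl S \<pi> \<mu>2 i \<omega>)"
    using Suc.IH n by simp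
  then have pres: "AE \<omega> in base S. sched S \<pi> \<mu>1 n \<omega> = sched S \<pi> \<mu>2 n \<omega> \<and> obs S \<pi> \<mu>1 n \<omega> = obs S \<pi> \<mu>2 n \<omega>"
  proof eventually_elim
    case (elim \<omega>)
    have "sched_info S \<pi> \<mu>1 n \<omega> = sched_info S \<pi> \<mu>2 n \<omega>"
      unfolding sched_info_def using elim by (auto intro!: restrict_ext)
    then have D: "sched S \<pi> \<mu>1 n \<omega> = sched S \<pi> \<mu>2 n \<omega>" by (simp add: sched_eq_sched_info)
    then have "sched S \<pi> \<mu>1 i \<omega> = sched S \<pi> \<mu>2 i \<omega>" if "i \<le> n" for i
      using that elim by (cases "i = n") auto
    with D elim show ?case by (simp add: obs_eq)
  qed
  from IH pres have "AE \<omega> in base S. control_info S \<pi> \<mu>1 n \<omega> = control_info S \<pi> \<mu>2 n \<omega>"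
  proof eventually_elim
    case (elim \<omega>)
    then have "obs S \<pi> \<mu>1 i \<omega> = obs S \<pi> \<mu>2 i \<omega>" if "i \<le> n" for i
      using that by (cases "i = n") auto
    with elim show ?case unfolding control_info_def by (auto intro!: restrict_ext)
  qed
  moreover have "AE \<omega> in base S. state S \<pi> \<mu>1 n \<omega> = state S \<pi> \<mu>2 n \<omega>"
    using IH by eventually_elim simp
  ultimately have "AE \<omega> in base S. state_estimate S \<pi> \<mu>1 n \<omega> = state_estimate S \<pi> \<mu>2 n \<omega>"
    unfolding state_estimate_def control_info_algebra_def using n
    by (intro real_cond_exp_AE_cong control_info_measurable L1.policies L2.policies
        square_integrable_integrable admissible_L2(2)[OF adm1] admissible_L2(2)[OF adm2]) auto
  from IH pres this ce1[rule_format, OF n] ce2[rule_format, OF n] show ?case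
  proof eventually_elim
    case (elim \<omega>)
    then have "ctrl S \<pi> \<mu>1 n \<omega> = ctrl S \<pi> \<mu>2 n \<omega>" by simp
    with elim show ?case by (auto simp: le_Suc_eq less_Suc_eq state.simps)
  qed
qed

lemma certainty_equivalent_loop_optimal:
  assumes opt: "optimal S \<pi> \<mu>'" and adm: "admissible S \<pi> \<mu>"
    and ce': "certainty_equivalent \<pi> \<mu>'"
    and ce: "certainty_equivalent \<pi> \<mu>"
  shows "optimal S \<pi> \<mu>"
proof -
  have feas': "feasible S \<pi> \<mu>'" and adm': "admissible S \<pi> \<mu>'"
    using opt by (auto simp: optimal_def feasible_def)
  have pol: "\<pi> \<in> sched_policies" "\<mu> \<in> control_policies" "\<mu>' \<in> control_policies"
    using adm adm' by (auto simp: admissible_def)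
  note same = certainty_equivalent_loop_unique[OF adm adm' ce ce' order.refl]
  have "AE \<omega> in base S. 1 / real (horizon S) * (\<Sum>k<horizon S. sched S \<pi> \<mu>' k \<omega>) \<le> rate S"
    using feas' by (auto simp: feasible_def)
  with same have "AE \<omega> in base S. 1 / real (horizon S) * (\<Sum>k<horizon S. sched S \<pi> \<mu> k \<omega>) \<le> rate S"
    by eventually_elim simp
  then have "feasible S \<pi> \<mu>" using adm by (simp add: feasible_def)
  moreover have "cost S \<pi> \<mu> = cost S \<pi> \<mu>'"
  proof -
    note [measurable] = measurable_base[OF pol(1,2)] measurable_base[OF pol(1,3)]
    show ?thesis unfolding cost_def
      by (intro arg_cong2[where f="(*)"] refl integral_cong_AE)
        (measurable, use same in eventually_elim, simp)
  qed
  ultimately show ?thesis using opt by (simp add: optimal_def)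
qed

end

theorem theorem1:
  fixes S :: "'a control_problem" and \<pi> :: sched_policy and \<mu>_opt :: control_policy
  assumes "prob_space (base S)"
    and init_sq: "integrable (base S) (\<lambda>\<omega>. (init S \<omega>)\<^sup>2)"
    and indep: "prob_space.indep_vars (base S) (\<lambda>_. borel) (case_nat (init S) (noise S)) UNIV"
    and ident: "\<And>k. distr (base S) borel (noise S k) = distr (base S) borel (noise S 0)"
    and mean: "\<And>k. (LINT \<omega>|base S. noise S k \<omega>) = 0"
    and var: "\<And>k. integrable (base S) (\<lambda>\<omega>. (noise S k \<omega>)\<^sup>2)"
    and symm: "\<And>k. distr (base S) borel (\<lambda>\<omega>. - noise S k \<omega>) = distr (base S) borel (noise S k)"
    and "1 \<le> delay S" and "1 \<le> horizon S"
    and "weight_q S > 0" and "weight_r S > 0" and "rate S > 0"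
    and optimal: "optimal S \<pi> \<mu>_opt"
  shows "\<forall>\<mu>. optimal S \<pi> \<mu> \<longleftrightarrow>
           admissible S \<pi> \<mu> \<and>
           (\<forall>k<horizon S. AE \<omega> in base S.
              ctrl S \<pi> \<mu> k \<omega> = - gain S k * state_estimate S \<pi> \<mu> k \<omega>)"
proof -
  interpret lq_system S
    by (rule lq_system.intro) (fact assms)+
  have necessary: "admissible S \<pi> \<mu> \<and> certainty_equivalent \<pi> \<mu>" if "optimal S \<pi> \<mu>" for \<mu>
  proof -
    have adm: "admissible S \<pi> \<mu>" using that by (auto simp: optimal_def feasible_def)
    interpret reference_loop S \<pi> \<mu> by unfold_locales (rule adm)
    show ?thesis using adm optimal_certainty_equivalent[OF that] by blast
  qed
  then show ?thesis
    using certainty_equivalent_loop_optimal[OF optimal] optimal by blast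
qed

end
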